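(* Let $I$ and $J$ be two skew-symmetric $(1,1)$-tensors on a pre-Courant (respectively, Courant) algebroid $(E,\Theta)$ such that $\Theta_{\{J,\{I,J\}\}}=\lambda_0\,\Theta_{J,J,I}$ for some $\lambda_0\in\mathbb{R}\setminus\{\frac{4}{(-3)^m-1} : m\in\mathbb{N},\ m\ge 1\}$. If $(J,I)$ is a deforming-Nijenhuis pair for $\Theta$, then $(J,I^{2n+1})$ is a deforming-Nijenhuis pair for the pre-Courant (respectively, Courant) structures $\Theta_k$, for all $k,n\in\mathbb{N}$.
   Context: $E\to M$ is a real vector bundle over a smooth manifold with a fibrewise non-degenerate symmetric bilinear form $\langle\cdot,\cdot\rangle$. A pre-Courant structure $\Theta$ on it is a pair $(\rho,[\cdot,\cdot])$, where $\rho:E\to TM$ is a bundle map and $[\cdot,\cdot]$ is an $\mathbb{R}$-bilinear, not necessarily skew-symmetric, bracket on $\Gamma(E)$ such that, for all $X,Y,Z\in\Gamma(E)$, $\rho(X)\cdot\langle Y,Z\rangle=\langle[X,Y],Z\rangle+\langle Y,[X,Z]\rangle$ and $\rho(X)\cdot\langle Y,Z\rangle=\langle X,[Y,Z]+[Z,Y]\rangle$. It is a Courant structure if moreover $[X,[Y,Z]]=[[X,Y],Z]+[Y,[X,Z]]$ for all $X,Y,Z$. Then $(E,\Theta)$ is a pre-Courant (resp. Courant) algebroid. Sums and scalar multiples of pre-Courant structures are taken componentwise. A $(1,1)$-tensor is a vector bundle endomorphism of $E$ over $\mathrm{id}_M$; $J$ is skew-symmetric if $\langle Ju,v\rangle+\langle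 u,Jv\rangle=0$. For $J$ skew-symmetric, $\Theta_J=(\rho\circ J,[\cdot,\cdot]_J)$ with $[X,Y]_J=[JX,Y]+[X,JY]-J[X,Y]$, which is again a pre-Courant structure. Write $\Theta_{I,J,\dots,T}=(((\Theta_I)_J)_{\dots})_T$. $\Theta_0=\Theta$ and $\Theta_k=(\Theta_{k-1})_I$ ($k$ successive deformations by $I$). For skew-symmetric $I,J$, $\{J,I\}$ denotes the skew-symmetric $(1,1)$-tensor $I\circ J-J\circ I$ (the Poisson bracket of the corresponding degree 2 functions in the supergeometric formalism). $I^n$ is the $n$-fold composition. $\mathbb{N}$ includes $0$. $I$ is Nijenhuis for $\Theta$ if $[IX,IY]-I([X,Y]_I)=0$ for all $X,Y\in\Gamma(E)$. A skew-symmetric $J$ is deforming for $\Theta$ if $\Theta_{J,J}=\eta\,\Theta$ for some $\eta\in\mathbb{R}$. A pair of skew-symmetric $(1,1)$-tensors $(I,J)$ is a compatible pair w.r.t. $\Theta$ if $I\circ J=-J\circ I$ and $C_\Theta(I,J):=\Theta_{I,J}+\Theta_{J,I}=0$. $(J,I)$ is a deforming-Nijenhuis pair for $\Theta$ if $(J,I)$ is a compatible pair w.r.t. $\Theta$, $J$ is deforming for $\Theta$ and $I$ is Nijenhuis for $\Theta$. *)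

theory Defs
  imports "HOL-Analysis.Analysis"
begin

section \<open>Smooth functions on open subsets of R^n\<close>

text \<open>
  As in \<open>Euclidean_space n\<close>, a point of R^n is a sequence \<open>nat \<Rightarrow> real\<close> vanishing from index n on,
  so that the dimension is a natural number and may be 0.
  \<open>Ck_on\<close> and \<open>smooth_on\<close> are meant for sets U that are open in \<open>Euclidean_space n\<close>.
\<close>

definition partial :: "nat \<Rightarrow> ((nat \<Rightarrow> real) \<Rightarrow> real) \<Rightarrow> (nat \<Rightarrow> real) \<Rightarrow> real" where
  "partial i f x = deriv (\<lambda>t. f (x(i := t))) (x i)"

primrec Ck_on :: "nat \<Rightarrow> nat \<Rightarrow> (nat \<Rightarrow> real) set \<Rightarrow> ((nat \<Rightarrow> real) \<Rightarrow> real) \<Rightarrow> bool" where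
  "Ck_on n 0 U f \<longleftrightarrow> continuous_on U f"
| "Ck_on n (Suc k) U f \<longleftrightarrow> continuous_on U f \<and>
     (\<forall>i<n. (\<forall>x\<in>U. (\<lambda>t. f (x(i := t))) differentiable (at (x i))) \<and> Ck_on n k U (partial i f))"

definition smooth_on :: "nat \<Rightarrow> (nat \<Rightarrow> real) set \<Rightarrow> ((nat \<Rightarrow> real) \<Rightarrow> real) \<Rightarrow> bool" where
  "smooth_on n U f \<longleftrightarrow> (\<forall>k. Ck_on n k U f)"


section \<open>Smooth manifolds\<close>

text \<open>
  The underlying space of the manifold is a Hausdorff, second countable type \<open>'m\<close>;
  a chart is a pair (domain, coordinate map).
\<close>

type_synonym 'm chart = "'m set \<times> ('m \<Rightarrow> nat \<Rightarrow> real)"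

definition is_chart :: "nat \<Rightarrow> 'm::topological_space chart \<Rightarrow> bool" where
  "is_chart n = (\<lambda>(U, \<phi>). open U \<and> openin (Euclidean_space n) (\<phi> ` U) \<and>
     homeomorphic_map (top_of_set U) (subtopology (Euclidean_space n) (\<phi> ` U)) \<phi>)"

definition in_chart :: "'m chart \<Rightarrow> ('m \<Rightarrow> real) \<Rightarrow> (nat \<Rightarrow> real) \<Rightarrow> real" where
  "in_chart c f = f \<circ> inv_into (fst c) (snd c)"

definition smooth_atlas :: "nat \<Rightarrow> 'm::topological_space chart set \<Rightarrow> bool" where
  "smooth_atlas n A \<longleftrightarrow> (\<forall>c\<in>A. is_chart n c) \<and> (\<Union>c\<in>A. fst c) = UNIV \<and>
     (\<forall>c\<in>A. \<forall>d\<in>A. \<forall>i<n. smooth_on n (snd c ` (fst c \<inter> fst d)) (in_chart c (\<lambda>p. snd d p i)))"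

definition smooth_fun_on :: "nat \<Rightarrow> 'm::topological_space chart set \<Rightarrow> 'm set \<Rightarrow> ('m \<Rightarrow> real) \<Rightarrow> bool" where
  "smooth_fun_on n A W f \<longleftrightarrow> (\<forall>c\<in>A. smooth_on n (snd c ` (fst c \<inter> W)) (in_chart c f))"

text \<open>
  A tangent vector at p is the family of its coordinate vectors in all charts around p, subject to
  the transformation law given by the Jacobians of the coordinate changes (and set to 0 at
  charts not containing p, so that tangent vectors are equal iff they agree in charts around p).
\<close>

type_synonym 'm tangent_vector = "'m chart \<Rightarrow> nat \<Rightarrow> real"

definition tangent_space :: "nat \<Rightarrow> 'm chart set \<Rightarrow> 'm \<Rightarrow> 'm tangent_vector set" where
  "tangent_space n A p = {v.
     (\<forall>c i. \<not> (c \<in> A \<and> p \<in> fst c \<and> i < n) \<longrightarrow> v c i = 0) \<and>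
     (\<forall>c\<in>A. \<forall>d\<in>A. p \<in> fst c \<longrightarrow> p \<in> fst d \<longrightarrow>
        (\<forall>i<n. v d i = (\<Sum>j<n. partial j (in_chart c (\<lambda>q. snd d q i)) (snd c p) * v c j)))}"

text \<open>Derivative of f along v at p; by the chain rule it does not depend on the chosen chart.\<close>

definition tangent_act :: "nat \<Rightarrow> 'm chart set \<Rightarrow> 'm \<Rightarrow> 'm tangent_vector \<Rightarrow> ('m \<Rightarrow> real) \<Rightarrow> real" where
  "tangent_act n A p v f = (let c = (SOME c. c \<in> A \<and> p \<in> fst c)
     in \<Sum>i<n. v c i * partial i (in_chart c f) (snd c p))"


section \<open>Vector bundles with a fibrewise non-degenerate symmetric bilinear form\<close>

text \<open>
  The fibres are given as subspaces of an ambient real vector space \<open>'v\<close>; this is no restriction,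
  since any family of vector spaces embeds into its direct sum, and the ambient space carries
  neither topology nor smooth structure: these come from the local trivialisations
  (U, \<open>\<Phi>\<close>), where \<open>\<Phi> p\<close> is a linear isomorphism from the fibre over p to R^r for p in U.
\<close>

record ('m, 'v) metric_bundle =
  dim_base :: nat
  atlas :: "'m chart set"
  rank :: nat
  fibre :: "'m \<Rightarrow> 'v set"
  trivs :: "('m set \<times> ('m \<Rightarrow> 'v \<Rightarrow> nat \<Rightarrow> real)) set"
  metric :: "'m \<Rightarrow> 'v \<Rightarrow> 'v \<Rightarrow> real"

definition linear_on :: "'v::real_vector set \<Rightarrow> ('v \<Rightarrow> 'w::real_vector) \<Rightarrow> bool" where
  "linear_on S f \<longleftrightarrow> (\<forall>u\<in>S. \<forall>v\<in>S. f (u + v) = f u + f v) \<and> (\<forall>a. \<forall>u\<in>S. f (a *\<^sub>R u) = a *\<^sub>R f u)"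

abbreviation smooth_base_fun ::
  "('m::topological_space, 'v) metric_bundle \<Rightarrow> 'm set \<Rightarrow> ('m \<Rightarrow> real) \<Rightarrow> bool" where
  "smooth_base_fun B \<equiv> smooth_fun_on (dim_base B) (atlas B)"

definition local_frame :: "('m, 'v) metric_bundle \<Rightarrow> ('m \<Rightarrow> 'v \<Rightarrow> nat \<Rightarrow> real) \<Rightarrow> nat \<Rightarrow> 'm \<Rightarrow> 'v" where
  "local_frame B \<Phi> j p = inv_into (fibre B p) (\<Phi> p) (\<lambda>i. if i = j then 1 else 0)"

definition vector_bundle ::
  "('m::{t2_space,second_countable_topology}, 'v::real_vector) metric_bundle \<Rightarrow> bool" where
  "vector_bundle B \<longleftrightarrow>
     smooth_atlas (dim_base B) (atlas B) \<and>
     (\<forall>p. subspace (fibre B p)) \<and>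
     (\<Union>(U, \<Phi>)\<in>trivs B. U) = UNIV \<and>
     (\<forall>(U, \<Phi>)\<in>trivs B. open U \<and>
        (\<forall>p\<in>U. (\<forall>i. linear_on (fibre B p) (\<lambda>v. \<Phi> p v i)) \<and>
                bij_betw (\<Phi> p) (fibre B p) (topspace (Euclidean_space (rank B))))) \<and>
     (\<forall>(U, \<Phi>)\<in>trivs B. \<forall>(V, \<Psi>)\<in>trivs B. \<forall>i<rank B. \<forall>j<rank B.
        smooth_base_fun B (U \<inter> V) (\<lambda>p. \<Psi> p (local_frame B \<Phi> j p) i))"

definition metric_vector_bundle ::
  "('m::{t2_space,second_countable_topology}, 'v::real_vector) metric_bundle \<Rightarrow> bool" where
  "metric_vector_bundle B \<longleftrightarrow> vector_bundle B \<and>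
     (\<forall>p. \<forall>u\<in>fibre B p. linear_on (fibre B p) (metric B p u)) \<and>
     (\<forall>p. \<forall>u\<in>fibre B p. \<forall>v\<in>fibre B p. metric B p u v = metric B p v u) \<and>
     (\<forall>p. \<forall>u\<in>fibre B p. (\<forall>v\<in>fibre B p. metric B p u v = 0) \<longrightarrow> u = 0) \<and>
     (\<forall>(U, \<Phi>)\<in>trivs B. \<forall>i<rank B. \<forall>j<rank B.
        smooth_base_fun B U (\<lambda>p. metric B p (local_frame B \<Phi> i p) (local_frame B \<Phi> j p)))"

definition sections :: "('m::topological_space, 'v) metric_bundle \<Rightarrow> ('m \<Rightarrow> 'v) set" where
  "sections B = {X. (\<forall>p. X p \<in> fibre B p) \<and>
     (\<forall>(U, \<Phi>)\<in>trivs B. \<forall>i<rank B. smooth_base_fun B U (\<lambda>p. \<Phi> p (X p) i))}"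


section \<open>(1,1)-tensors\<close>

text \<open>
  Only the restriction of \<open>J p\<close> to the fibre over p is meaningful; accordingly all conditions below
  are imposed on the fibres only.
\<close>

type_synonym ('m, 'v) tensor = "'m \<Rightarrow> 'v \<Rightarrow> 'v"

definition tensor :: "('m::topological_space, 'v::real_vector) metric_bundle \<Rightarrow> ('m, 'v) tensor \<Rightarrow> bool" where
  "tensor B J \<longleftrightarrow>
     (\<forall>p. J p ` fibre B p \<subseteq> fibre B p \<and> linear_on (fibre B p) (J p)) \<and>
     (\<forall>(U, \<Phi>)\<in>trivs B. \<forall>i<rank B. \<forall>j<rank B.
        smooth_base_fun B U (\<lambda>p. \<Phi> p (J p (local_frame B \<Phi> j p)) i))"

definition skew_tensor :: "('m::topological_space, 'v::real_vector) metric_bundle \<Rightarrow> ('m, 'v) tensor \<Rightarrow> bool" where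
  "skew_tensor B J \<longleftrightarrow> tensor B J \<and>
     (\<forall>p. \<forall>u\<in>fibre B p. \<forall>v\<in>fibre B p. metric B p (J p u) v + metric B p u (J p v) = 0)"

definition tensor_app :: "('m, 'v) tensor \<Rightarrow> ('m \<Rightarrow> 'v) \<Rightarrow> 'm \<Rightarrow> 'v" where
  "tensor_app J X = (\<lambda>p. J p (X p))"

text \<open>\<open>tensor_bracket J I\<close> is \<open>{J, I} = I \<circ> J - J \<circ> I\<close>; note the order.\<close>

definition tensor_bracket :: "('m, 'v::real_vector) tensor \<Rightarrow> ('m, 'v) tensor \<Rightarrow> ('m, 'v) tensor" where
  "tensor_bracket J I = (\<lambda>p v. I p (J p v) - J p (I p v))"

definition tensor_power :: "('m, 'v) tensor \<Rightarrow> nat \<Rightarrow> ('m, 'v) tensor" where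
  "tensor_power I n = (\<lambda>p. I p ^^ n)"


section \<open>Pre-Courant and Courant structures\<close>

text \<open>
  The bracket is a function on sections, and the anchor at p is a function on the fibre over p.
  Values at other arguments are junk, which is why structures are compared by \<open>struct_eq\<close>.
\<close>

record ('m, 'v) courant_data =
  anchor :: "'m \<Rightarrow> 'v \<Rightarrow> 'm tangent_vector"
  bracket :: "('m \<Rightarrow> 'v) \<Rightarrow> ('m \<Rightarrow> 'v) \<Rightarrow> 'm \<Rightarrow> 'v"

definition struct_eq ::
  "('m::topological_space, 'v) metric_bundle \<Rightarrow> ('m, 'v) courant_data \<Rightarrow> ('m, 'v) courant_data \<Rightarrow> bool" where
  "struct_eq B \<Theta> \<Theta>' \<longleftrightarrow>
     (\<forall>p. \<forall>u\<in>fibre B p. anchor \<Theta> p u = anchor \<Theta>' p u) \<and>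
     (\<forall>X\<in>sections B. \<forall>Y\<in>sections B. bracket \<Theta> X Y = bracket \<Theta>' X Y)"

definition struct_zero :: "('m, 'v::real_vector) courant_data" where
  "struct_zero = \<lparr>anchor = (\<lambda>p u c i. 0), bracket = (\<lambda>X Y p. 0)\<rparr>"

definition struct_add ::
  "('m, 'v::real_vector) courant_data \<Rightarrow> ('m, 'v) courant_data \<Rightarrow> ('m, 'v) courant_data" where
  "struct_add \<Theta> \<Theta>' =
     \<lparr>anchor = (\<lambda>p u c i. anchor \<Theta> p u c i + anchor \<Theta>' p u c i),
      bracket = (\<lambda>X Y p. bracket \<Theta> X Y p + bracket \<Theta>' X Y p)\<rparr>"

definition struct_scale :: "real \<Rightarrow> ('m, 'v::real_vector) courant_data \<Rightarrow> ('m, 'v) courant_data" where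
  "struct_scale a \<Theta> =
     \<lparr>anchor = (\<lambda>p u c i. a * anchor \<Theta> p u c i), bracket = (\<lambda>X Y p. a *\<^sub>R bracket \<Theta> X Y p)\<rparr>"

text \<open>Smooth bundle maps from the bundle to the tangent bundle of the base, over the identity.\<close>

definition anchor_map ::
  "('m::topological_space, 'v::real_vector) metric_bundle \<Rightarrow> ('m \<Rightarrow> 'v \<Rightarrow> 'm tangent_vector) \<Rightarrow> bool" where
  "anchor_map B \<rho> \<longleftrightarrow>
     (\<forall>p. \<rho> p ` fibre B p \<subseteq> tangent_space (dim_base B) (atlas B) p \<and>
          (\<forall>c i. linear_on (fibre B p) (\<lambda>u. \<rho> p u c i))) \<and>
     (\<forall>(U, \<Phi>)\<in>trivs B. \<forall>c\<in>atlas B. \<forall>i<dim_base B. \<forall>j<rank B.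
        smooth_base_fun B (U \<inter> fst c) (\<lambda>p. \<rho> p (local_frame B \<Phi> j p) c i))"

definition bilinear_bracket ::
  "('m::topological_space, 'v::real_vector) metric_bundle \<Rightarrow>
   (('m \<Rightarrow> 'v) \<Rightarrow> ('m \<Rightarrow> 'v) \<Rightarrow> 'm \<Rightarrow> 'v) \<Rightarrow> bool" where
  "bilinear_bracket B br \<longleftrightarrow>
     (\<forall>X\<in>sections B. \<forall>Y\<in>sections B. br X Y \<in> sections B) \<and>
     (\<forall>X\<in>sections B. \<forall>Y\<in>sections B. \<forall>Z\<in>sections B. \<forall>a b.
        br (\<lambda>p. a *\<^sub>R X p + b *\<^sub>R Y p) Z = (\<lambda>p. a *\<^sub>R br X Z p + b *\<^sub>R br Y Z p) \<and>
        br Z (\<lambda>p. a *\<^sub>R X p + b *\<^sub>R Y p) = (\<lambda>p. a *\<^sub>R br Z X p + b *\<^sub>R br Z Y p))"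

definition anchor_act ::
  "('m, 'v) metric_bundle \<Rightarrow> ('m, 'v) courant_data \<Rightarrow> ('m \<Rightarrow> 'v) \<Rightarrow> ('m \<Rightarrow> real) \<Rightarrow> 'm \<Rightarrow> real" where
  "anchor_act B \<Theta> X f = (\<lambda>p. tangent_act (dim_base B) (atlas B) p (anchor \<Theta> p (X p)) f)"

definition pre_courant ::
  "('m::topological_space, 'v::real_vector) metric_bundle \<Rightarrow> ('m, 'v) courant_data \<Rightarrow> bool" where
  "pre_courant B \<Theta> \<longleftrightarrow> anchor_map B (anchor \<Theta>) \<and> bilinear_bracket B (bracket \<Theta>) \<and>
     (\<forall>X\<in>sections B. \<forall>Y\<in>sections B. \<forall>Z\<in>sections B. \<forall>p.
        anchor_act B \<Theta> X (\<lambda>q. metric B q (Y q) (Z q)) p =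
          metric B p (bracket \<Theta> X Y p) (Z p) + metric B p (Y p) (bracket \<Theta> X Z p) \<and>
        anchor_act B \<Theta> X (\<lambda>q. metric B q (Y q) (Z q)) p =
          metric B p (X p) (bracket \<Theta> Y Z p + bracket \<Theta> Z Y p))"

definition courant ::
  "('m::topological_space, 'v::real_vector) metric_bundle \<Rightarrow> ('m, 'v) courant_data \<Rightarrow> bool" where
  "courant B \<Theta> \<longleftrightarrow> pre_courant B \<Theta> \<and>
     (\<forall>X\<in>sections B. \<forall>Y\<in>sections B. \<forall>Z\<in>sections B. \<forall>p.
        bracket \<Theta> X (bracket \<Theta> Y Z) p =
          bracket \<Theta> (bracket \<Theta> X Y) Z p + bracket \<Theta> Y (bracket \<Theta> X Z) p)"


section \<open>Deformations, Nijenhuis tensors and deforming-Nijenhuis pairs\<close>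

text \<open>
  \<open>deform J \<Theta>\<close> is \<open>\<Theta>\<^sub>J\<close>. Hence \<open>\<Theta>\<^sub>I\<^sub>,\<^sub>J = (\<Theta>\<^sub>I)\<^sub>J\<close> is \<open>deform J (deform I \<Theta>)\<close>.
\<close>

definition deform ::
  "('m, 'v::real_vector) tensor \<Rightarrow> ('m, 'v) courant_data \<Rightarrow> ('m, 'v) courant_data" where
  "deform J \<Theta> =
     \<lparr>anchor = (\<lambda>p u. anchor \<Theta> p (J p u)),
      bracket = (\<lambda>X Y p. bracket \<Theta> (tensor_app J X) Y p + bracket \<Theta> X (tensor_app J Y) p
                          - J p (bracket \<Theta> X Y p))\<rparr>"

definition deform_iter ::
  "('m, 'v::real_vector) tensor \<Rightarrow> nat \<Rightarrow> ('m, 'v) courant_data \<Rightarrow> ('m, 'v) courant_data" where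
  "deform_iter I k = deform I ^^ k"

definition nijenhuis ::
  "('m::topological_space, 'v::real_vector) metric_bundle \<Rightarrow> ('m, 'v) courant_data \<Rightarrow> ('m, 'v) tensor \<Rightarrow> bool" where
  "nijenhuis B \<Theta> I \<longleftrightarrow> tensor B I \<and>
     (\<forall>X\<in>sections B. \<forall>Y\<in>sections B. \<forall>p.
        bracket \<Theta> (tensor_app I X) (tensor_app I Y) p - I p (bracket (deform I \<Theta>) X Y p) = 0)"

definition deforming ::
  "('m::topological_space, 'v::real_vector) metric_bundle \<Rightarrow> ('m, 'v) courant_data \<Rightarrow> ('m, 'v) tensor \<Rightarrow> bool" where
  "deforming B \<Theta> J \<longleftrightarrow> skew_tensor B J \<and>
     (\<exists>\<eta>. struct_eq B (deform J (deform J \<Theta>)) (struct_scale \<eta> \<Theta>))"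

definition concomitant ::
  "('m, 'v::real_vector) courant_data \<Rightarrow> ('m, 'v) tensor \<Rightarrow> ('m, 'v) tensor \<Rightarrow> ('m, 'v) courant_data" where
  "concomitant \<Theta> I J = struct_add (deform J (deform I \<Theta>)) (deform I (deform J \<Theta>))"

definition compatible_pair ::
  "('m::topological_space, 'v::real_vector) metric_bundle \<Rightarrow> ('m, 'v) courant_data \<Rightarrow>
   ('m, 'v) tensor \<Rightarrow> ('m, 'v) tensor \<Rightarrow> bool" where
  "compatible_pair B \<Theta> I J \<longleftrightarrow> skew_tensor B I \<and> skew_tensor B J \<and>
     (\<forall>p. \<forall>u\<in>fibre B p. I p (J p u) = - J p (I p u)) \<and>
     struct_eq B (concomitant \<Theta> I J) struct_zero"

definition deforming_nijenhuis_pair ::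
  "('m::topological_space, 'v::real_vector) metric_bundle \<Rightarrow> ('m, 'v) courant_data \<Rightarrow>
   ('m, 'v) tensor \<Rightarrow> ('m, 'v) tensor \<Rightarrow> bool" where
  "deforming_nijenhuis_pair B \<Theta> J I \<longleftrightarrow>
     compatible_pair B \<Theta> J I \<and> deforming B \<Theta> J \<and> nijenhuis B \<Theta> I"

end

theory Submission
  imports Defs
begin

text \<open>
  All conditions on brackets can be read at a single point p, where the bracket is a map from pairs
  of sections to a vector space on which \<open>I\<close> and \<open>J\<close> act as anticommuting linear maps. Write \<open>D\<^sub>A\<close> for
  deformation by \<open>A\<close>. Compatibility and the vanishing of the torsion of \<open>I\<close> give
  \<open>[I\<^sup>2X, JY] = I\<^sup>2[X, JY] + J[I\<^sup>2X, Y] - I\<^sup>2J[X, Y]\<close> and its mirror image; from this identity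
  compatibility passes to \<open>D\<^sub>I \<Theta>\<close> and to odd powers of \<open>I\<close>, while the torsion behaves well
  under both for a general reason.

  As for the deforming condition, compatibility alone yields
  \<open>3 D\<^sub>J\<^sup>2 D\<^sub>I \<Theta> = 4 D\<^bsub>IJJ\<^esub> \<Theta> - D\<^sub>I D\<^sub>J\<^sup>2 \<Theta>\<close>. Since \<open>{J,{I,J}} = - 4 I J\<^sup>2\<close>, the assumption on the double
  bracket says \<open>D\<^bsub>IJJ\<^esub> \<Theta> = \<mu> D\<^sub>I \<Theta>\<close>. This relation is inherited by every \<open>\<Theta>\<^sub>k\<close> because \<open>D\<^bsub>IJJ\<^esub>\<close> and
  \<open>D\<^sub>I\<close> commute, so \<open>D\<^sub>J\<^sup>2 \<Theta>\<^sub>k = \<eta>\<^sub>k \<Theta>\<^sub>k\<close> with \<open>\<eta>\<^sub>k\<^sub>+\<^sub>1 = (4 \<mu> - \<eta>\<^sub>k) / 3\<close>.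
\<close>

section \<open>Smooth functions\<close>

text \<open>A partial derivative sees only the line through \<open>x\<close> in direction
  \<open>i\<close>. The slice map is continuous and, because \<open>i < n\<close>, stays among the
  sequences that vanish from \<open>n\<close> on, so openness of \<open>U\<close> provides a full
  neighbourhood of the parameter \<open>x i\<close>.\<close>

lemma openin_Euclidean_space_slice:
  assumes "openin (Euclidean_space n) U" "x \<in> U" "i < n"
  shows "\<forall>\<^sub>F t in nhds (x i). x(i := t) \<in> U"
proof -
  obtain T where T: "open T" and U: "U = T \<inter> {x. \<forall>i\<ge>n. x i = 0}"
    using assms(1) by (auto simp: Euclidean_space_def openin_subtopology euclidean_product_topology)
  have "continuous_on UNIV (\<lambda>t. x(i := t))"
  proof (rule continuous_on_coordinatewise_then_product)
    show "continuous_on UNIV (\<lambda>t. (x(i := t)) j)" for j by (cases "j = i") auto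
  qed
  then have "open ((\<lambda>t. x(i := t)) -` T)"
    using T by (simp add: open_vimage)
  then have "\<forall>\<^sub>F t in nhds (x i). t \<in> (\<lambda>t. x(i := t)) -` T"
    using assms(2) U by (intro eventually_nhds_in_open) auto
  then show ?thesis
    by eventually_elim (use assms U in auto)
qed

lemma slice_cong:
  assumes "openin (Euclidean_space n) U" "x \<in> U" "i < n" "\<And>x. x \<in> U \<Longrightarrow> f x = g x"
  shows "\<forall>\<^sub>F t in nhds (x i). f (x(i := t)) = g (x(i := t))"
  using openin_Euclidean_space_slice[OF assms(1-3)] by eventually_elim (rule assms(4))

lemma partial_cong:
  assumes "openin (Euclidean_space n) U" "x \<in> U" "i < n" "\<And>x. x \<in> U \<Longrightarrow> f x = g x"
  shows "partial i f x = partial i g x"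
  unfolding partial_def by (rule deriv_cong_ev[OF slice_cong[OF assms]]) auto

lemma slice_differentiable_cong:
  fixes f g :: "(nat \<Rightarrow> real) \<Rightarrow> real"
  assumes U: "openin (Euclidean_space n) U" "x \<in> U" "i < n" and fg: "\<And>x. x \<in> U \<Longrightarrow> f x = g x"
    and f: "(\<lambda>t. f (x(i := t))) differentiable (at (x i))"
  shows "(\<lambda>t. g (x(i := t))) differentiable (at (x i))"
proof -
  have "((\<lambda>t. g (x(i := t))) has_real_derivative D) (at (x i))"
    if "((\<lambda>t. f (x(i := t))) has_real_derivative D) (at (x i))" for D
    using that DERIV_cong_ev[OF refl slice_cong[OF U, of f g] refl] fg by blast
  with f show ?thesis by (auto simp: real_differentiable_def)
qed

text \<open>Coordinate expressions take arbitrary values off the chart image, so regularity has to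
  depend on the values on \<open>U\<close> alone. Openness of \<open>U\<close> makes the partial
  derivatives agree on \<open>U\<close> too, which drives the induction.\<close>

lemma Ck_on_cong_imp:
  assumes "openin (Euclidean_space n) U" "\<And>x. x \<in> U \<Longrightarrow> f x = g x" "Ck_on n k U f"
  shows "Ck_on n k U g"
  using assms(2,3)
proof (induction k arbitrary: f g)
  case 0 then show ?case using continuous_on_cong[of U U f g] by simp
next
  case (Suc k)
  have "continuous_on U g" using Suc.prems continuous_on_cong[of U U f g] by simp
  moreover have "(\<lambda>t. g (x(i := t))) differentiable (at (x i))" if "i < n" "x \<in> U" for i x
    using Suc.prems that slice_differentiable_cong[OF assms(1), of x i f g] by auto
  moreover have "Ck_on n k U (partial i g)" if "i < n" for i
    using Suc.IH[of "partial i f" "partial i g"] partial_cong[OF assms(1) _ that, of _ f g]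
        Suc.prems that
    by auto
  ultimately show ?case by simp
qed

lemma Ck_on_SucD: "Ck_on n (Suc k) U f \<Longrightarrow> Ck_on n k U f"
  by (induction k arbitrary: f) auto

lemma Ck_on_const: "Ck_on n k U (\<lambda>x. c)"
proof (induction k arbitrary: c)
  case (Suc k)
  have "partial i (\<lambda>x. c) = (\<lambda>x. 0)" for i by (simp add: partial_def fun_eq_iff)
  with Suc show ?case by simp
qed simp

lemma
  assumes "(\<lambda>t. f (x(i := t))) differentiable (at (x i))"
      "(\<lambda>t. g (x(i := t))) differentiable (at (x i))"
  shows partial_add: "partial i (\<lambda>x. f x + g x) x = partial i f x + partial i g x"
    and partial_mult: "partial i (\<lambda>x. f x * g x) x = f x * partial i g x + partial i f x * g x"
  using assms unfolding partial_def
  by (auto simp: field_differentiable_def real_differentiable_def)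

lemma Ck_on_add:
  assumes U: "openin (Euclidean_space n) U"
  shows "Ck_on n k U f \<Longrightarrow> Ck_on n k U g \<Longrightarrow> Ck_on n k U (\<lambda>x. f x + g x)"
proof (induction k arbitrary: f g)
  case 0 then show ?case by (auto intro: continuous_on_add)
next
  case (Suc k)
  have "Ck_on n k U (partial i (\<lambda>x. f x + g x))" if "i < n" for i
    by (rule Ck_on_cong_imp[OF U _ Suc.IH[of "partial i f" "partial i g"]])
      (use Suc.prems that partial_add in auto)
  with Suc.prems show ?case by (auto intro: continuous_on_add)
qed

lemma Ck_on_mult:
  assumes U: "openin (Euclidean_space n) U"
  shows "Ck_on n k U f \<Longrightarrow> Ck_on n k U g \<Longrightarrow> Ck_on n k U (\<lambda>x. f x * g x)"
proof (induction k arbitrary: f g)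
  case 0 then show ?case by (auto intro: continuous_on_mult)
next
  case (Suc k)
  have "Ck_on n k U (partial i (\<lambda>x. f x * g x))" if i: "i < n" for i
  proof (rule Ck_on_cong_imp[OF U])
    \<comment> \<open>The product rule keeps \<open>f\<close> and \<open>g\<close> themselves as
      factors, so their order is lowered by \<open>Ck_on_SucD\<close> to fit the induction
      hypothesis.\<close>
    show "Ck_on n k U (\<lambda>x. f x * partial i g x + partial i f x * g x)"
      using Suc.prems[THEN Ck_on_SucD] Suc.prems i by (intro Ck_on_add[OF U] Suc.IH) auto
  qed (use Suc.prems i partial_mult in auto)
  with Suc.prems show ?case by (auto intro: continuous_on_mult)
qed

lemma Ck_on_subset: "Ck_on n k U f \<Longrightarrow> V \<subseteq> U \<Longrightarrow> Ck_on n k V f"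
  by (induction k arbitrary: f) (auto intro: continuous_on_subset)

section \<open>Charts and smooth functions on the manifold\<close>

text \<open>A chart is a homeomorphism onto an image that is open in
  \<open>Euclidean_space n\<close>, so it carries open sets to sets open there. This is the
  hypothesis on the domain in the calculus lemmas.\<close>

lemma openin_chart_image:
  assumes "smooth_atlas n A" "c \<in> A" "open W"
  shows "openin (Euclidean_space n) (snd c ` (fst c \<inter> W))"
proof -
  obtain U \<phi> where c: "c = (U, \<phi>)" by (cases c)
  then have *: "openin (Euclidean_space n) (\<phi> ` U)"
    "homeomorphic_map (top_of_set U) (subtopology (Euclidean_space n) (\<phi> ` U)) \<phi>"
    using assms by (auto simp: smooth_atlas_def is_chart_def)
  from homeomorphic_imp_open_map[OF *(2)]
  have "openin (subtopology (Euclidean_space n) (\<phi> ` U)) (\<phi> ` (U \<inter> W))"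
    using assms(3) by (auto simp: open_map_def intro: openin_open_Int)
  with * show ?thesis by (auto simp: c intro: openin_trans_full)
qed

lemma in_chart_image:
  assumes "smooth_atlas n A" "c \<in> A" "p \<in> fst c"
  shows "inv_into (fst c) (snd c) (snd c p) = p"
proof -
  have "inj_on (snd c) (fst c)"
    using assms by (auto simp: smooth_atlas_def is_chart_def homeomorphic_map_def split: prod.splits)
  with assms show ?thesis by simp
qed

lemma smooth_fun_on_cong_imp:
  assumes "smooth_atlas n A" "open W" "\<And>p. p \<in> W \<Longrightarrow> f p = g p" "smooth_fun_on n A W f"
  shows "smooth_fun_on n A W g"
  unfolding smooth_fun_on_def smooth_on_def
proof (intro ballI allI)
  fix c k assume c: "c \<in> A"
  show "Ck_on n k (snd c ` (fst c \<inter> W)) (in_chart c g)"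
  proof (rule Ck_on_cong_imp[OF openin_chart_image[OF assms(1) c assms(2)]])
    show "Ck_on n k (snd c ` (fst c \<inter> W)) (in_chart c f)"
      using assms(4) c by (auto simp: smooth_fun_on_def smooth_on_def)
  qed (use in_chart_image[OF assms(1) c] assms(3) in \<open>auto simp: in_chart_def\<close>)
qed

lemma smooth_fun_on_subset: "smooth_fun_on n A W f \<Longrightarrow> V \<subseteq> W \<Longrightarrow> smooth_fun_on n A V f"
  unfolding smooth_fun_on_def smooth_on_def by (meson Ck_on_subset Int_mono image_mono subset_refl)

lemma smooth_fun_on_const: "smooth_fun_on n A W (\<lambda>p. c)"
  by (simp add: smooth_fun_on_def smooth_on_def in_chart_def o_def Ck_on_const)

lemma
  assumes "smooth_atlas n A" "open W" "smooth_fun_on n A W f" "smooth_fun_on n A W g"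
  shows smooth_fun_on_add: "smooth_fun_on n A W (\<lambda>p. f p + g p)"
    and smooth_fun_on_mult: "smooth_fun_on n A W (\<lambda>p. f p * g p)"
  using assms Ck_on_add[OF openin_chart_image[OF assms(1) _ assms(2)]]
    Ck_on_mult[OF openin_chart_image[OF assms(1) _ assms(2)]]
  by (auto simp: smooth_fun_on_def smooth_on_def in_chart_def o_def)

lemma smooth_fun_on_sum:
  assumes "smooth_atlas n A" "open W" "\<And>j. j \<in> K \<Longrightarrow> smooth_fun_on n A W (f j)"
  shows "smooth_fun_on n A W (\<lambda>p. \<Sum>j\<in>K. f j p)"
  using assms(3)
  by (induction K rule: infinite_finite_induct)
    (auto intro: smooth_fun_on_const smooth_fun_on_add[OF assms(1,2)])

section \<open>Algebra of brackets with an anticommuting pair\<close>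

text \<open>Reduces linear identities between vectors to linear arithmetic over the reals.\<close>

lemma eq_if_functionals_eq:
  fixes u v :: "'v::real_vector"
  assumes "\<And>f :: 'v \<Rightarrow> real. linear f \<Longrightarrow> f u = f v"
  shows "u = v"
proof (rule ccontr)
  assume "u \<noteq> v"
  then have "independent {u - v}" by simp
  from linear_independent_extend[OF this, of "\<lambda>_. 1 :: real"]
  obtain f :: "'v \<Rightarrow> real" where "linear f" "f (u - v) = 1" by auto
  with assms[of f] show False by (simp add: linear_diff)
qed

lemmas linear_rules = linear_add linear_diff linear_neg linear_cmul linear_0

definition deform_at :: "('a \<Rightarrow> 'a) \<Rightarrow> ('v \<Rightarrow> 'v) \<Rightarrow> ('a \<Rightarrow> 'a \<Rightarrow> 'v) \<Rightarrow> 'a \<Rightarrow> 'a \<Rightarrow> 'v::real_vector" where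
  "deform_at i I b x y = b (i x) y + b x (i y) - I (b x y)"

text \<open>At a fixed point the arguments of a bracket are sections and its values are vectors, so
  each tensor occurs twice: as \<open>i\<close>, \<open>j\<close> on arguments and as
  \<open>I\<close>, \<open>J\<close> on values. Of the linear structure on arguments only the sign
  is kept, as an abstract \<open>neg\<close>, which suffices to say that \<open>i\<close> and
  \<open>j\<close> anticommute.\<close>

locale anticommuting_pair =
  fixes S :: "'a set" and i j neg :: "'a \<Rightarrow> 'a" and I J :: "'v::real_vector \<Rightarrow> 'v"
  assumes closed [simp]: "x \<in> S \<Longrightarrow> i x \<in> S" "x \<in> S \<Longrightarrow> j x \<in> S" "x \<in> S \<Longrightarrow> neg x \<in> S"
    and linear_I: "linear I" and linear_J: "linear J"
    and J_I: "J (I v) = - I (J v)"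
    and j_i: "x \<in> S \<Longrightarrow> j (i x) = neg (i (j x))"
    and i_neg: "x \<in> S \<Longrightarrow> i (neg x) = neg (i x)"
    and j_neg: "x \<in> S \<Longrightarrow> j (neg x) = neg (j x)"
    and neg_neg: "neg (neg x) = x"
begin

definition odd_bracket :: "('a \<Rightarrow> 'a \<Rightarrow> 'v) \<Rightarrow> bool" where
  "odd_bracket b \<longleftrightarrow> (\<forall>x\<in>S. \<forall>y\<in>S. b (neg x) y = - b x y \<and> b x (neg y) = - b x y)"

definition compatible :: "('a \<Rightarrow> 'a \<Rightarrow> 'v) \<Rightarrow> bool" where
  "compatible b \<longleftrightarrow> (\<forall>x\<in>S. \<forall>y\<in>S. b (i x) (j y) + b (j x) (i y) =
     J (b (i x) y) + J (b x (i y)) + I (b (j x) y) + I (b x (j y)))"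

definition torsionfree :: "('a \<Rightarrow> 'a \<Rightarrow> 'v) \<Rightarrow> bool" where
  "torsionfree b \<longleftrightarrow> (\<forall>x\<in>S. \<forall>y\<in>S. b (i x) (i y) = I (b (i x) y) + I (b x (i y)) - I (I (b x y)))"

definition square_deform :: "('a \<Rightarrow> 'a \<Rightarrow> 'v) \<Rightarrow> real \<Rightarrow> bool" where
  "square_deform b \<eta> \<longleftrightarrow>
     (\<forall>x\<in>S. \<forall>y\<in>S. deform_at j J (deform_at j J b) x y = \<eta> *\<^sub>R b x y)"

definition cubic_deform :: "('a \<Rightarrow> 'a \<Rightarrow> 'v) \<Rightarrow> real \<Rightarrow> bool" where
  "cubic_deform b \<mu> \<longleftrightarrow>
     (\<forall>x\<in>S. \<forall>y\<in>S. deform_at (\<lambda>x. i (j (j x))) (\<lambda>v. I (J (J v))) b x y = \<mu> *\<^sub>R deform_at i I b x y)"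

lemmas linear_IJ = linear_rules[OF linear_I] linear_rules[OF linear_J]
lemmas word_simps = j_i i_neg j_neg neg_neg J_I

lemma odd_bracketD:
  assumes "odd_bracket b" "x \<in> S" "y \<in> S"
  shows "b (neg x) y = - b x y" "b x (neg y) = - b x y"
  using assms by (auto simp: odd_bracket_def)

lemma compatibleD:
  assumes "compatible b" "x \<in> S" "y \<in> S"
  shows "b (i x) (j y) + b (j x) (i y) =
     J (b (i x) y) + J (b x (i y)) + I (b (j x) y) + I (b x (j y))"
  using assms by (auto simp: compatible_def)

lemma torsionfreeD:
  assumes "torsionfree b" "x \<in> S" "y \<in> S"
  shows "b (i x) (i y) = I (b (i x) y) + I (b x (i y)) - I (I (b x y))"
  using assms by (auto simp: torsionfree_def)

section \<open>Compatibility, torsion and the deforming condition under deformation by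
  \<open>i\<close>\<close>

text \<open>In the sum, terms with both maps on one argument or both on the value cancel by
  anticommutation; every other term occurs twice.\<close>

lemma concomitant_eq_0_iff:
  assumes "odd_bracket b" "x \<in> S" "y \<in> S"
  shows "deform_at i I (deform_at j J b) x y + deform_at j J (deform_at i I b) x y = 0 \<longleftrightarrow>
     b (i x) (j y) + b (j x) (i y) =
     J (b (i x) y) + J (b x (i y)) + I (b (j x) y) + I (b x (j y))" (is "?l = 0 \<longleftrightarrow> ?r = ?s")
proof -
  have "?l = 2 *\<^sub>R (?r - ?s)"
  proof (rule eq_if_functionals_eq)
    fix f :: "'v \<Rightarrow> real" assume f: "linear f"
    show "f ?l = f (2 *\<^sub>R (?r - ?s))"
      using assms by (simp add: deform_at_def word_simps odd_bracketD linear_IJ linear_rules[OF f])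
  qed
  then show ?thesis by simp
qed

text \<open>Let L and R be \<open>i\<close> acting in the first and in the second argument. As
  operators on brackets, L, R and \<open>I\<close> commute, the torsion is (L - I)(R - I) and the
  deformation is L + R - I. Hence the torsion of the deformed bracket is the deformation of the
  torsion.\<close>

lemma torsionfree_deform:
  assumes "torsionfree b"
  shows "torsionfree (deform_at i I b)"
  unfolding torsionfree_def deform_at_def
  using torsionfreeD[OF assms] by (auto simp: linear_IJ)

text \<open>Compatibility at \<open>(i x, y)\<close> contains \<open>b (j (i x)) (i y)\<close>,
  which anticommutation and vanishing torsion at \<open>(j x, y)\<close> resolve; the mixed brackets
  left over form \<open>I\<close> applied to the left side of compatibility at
  \<open>(x, y)\<close>. The second identity is the mirror image, starting from
  \<open>(x, i y)\<close>.\<close>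

lemma bracket_i_i_j:
  assumes b: "odd_bracket b" "compatible b" "torsionfree b" and xy: "x \<in> S" "y \<in> S"
  shows "b (i (i x)) (j y) = I (I (b x (j y))) + J (b (i (i x)) y) - I (I (J (b x y)))"
    and "b (j x) (i (i y)) = I (I (b (j x) y)) + J (b x (i (i y))) - I (I (J (b x y)))"
proof -
  note odd = odd_bracketD[OF b(1)] and N = torsionfreeD[OF b(3)]
  have C: "I (b (i x) (j y)) + I (b (j x) (i y)) =
     I (J (b (i x) y)) + I (J (b x (i y))) + I (I (b (j x) y)) + I (I (b x (j y)))"
    using arg_cong[OF compatibleD[OF b(2) xy], of I] by (simp add: linear_IJ)
  have "b (i (i x)) (j y) + b (j (i x)) (i y) =
     J (b (i (i x)) y) + J (b (i x) (i y)) + I (b (j (i x)) y) + I (b (i x) (j y))"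
    using compatibleD[OF b(2)] xy by simp
  then have C1: "b (i (i x)) (j y) - b (i (j x)) (i y) =
     J (b (i (i x)) y) + J (b (i x) (i y)) - I (b (i (j x)) y) + I (b (i x) (j y))"
    using xy by (simp add: word_simps odd linear_IJ)
  show "b (i (i x)) (j y) = I (I (b x (j y))) + J (b (i (i x)) y) - I (I (J (b x y)))"
  proof (rule eq_if_functionals_eq)
    fix f :: "'v \<Rightarrow> real" assume f: "linear f"
    show "f (b (i (i x)) (j y)) = f (I (I (b x (j y))) + J (b (i (i x)) y) - I (I (J (b x y))))"
      using arg_cong[OF C, of f] arg_cong[OF C1, of f] xy
      by (simp add: N linear_IJ word_simps linear_rules[OF f])
  qed
  have "b (i x) (j (i y)) + b (j x) (i (i y)) =
     J (b (i x) (i y)) + J (b x (i (i y))) + I (b (j x) (i y)) + I (b x (j (i y)))"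
    using compatibleD[OF b(2)] xy by simp
  then have C2: "b (j x) (i (i y)) - b (i x) (i (j y)) =
     J (b (i x) (i y)) + J (b x (i (i y))) + I (b (j x) (i y)) - I (b x (i (j y)))"
    using xy by (simp add: word_simps odd linear_IJ)
  show "b (j x) (i (i y)) = I (I (b (j x) y)) + J (b x (i (i y))) - I (I (J (b x y)))"
  proof (rule eq_if_functionals_eq)
    fix f :: "'v \<Rightarrow> real" assume f: "linear f"
    show "f (b (j x) (i (i y))) = f (I (I (b (j x) y)) + J (b x (i (i y))) - I (I (J (b x y))))"
      using arg_cong[OF C, of f] arg_cong[OF C2, of f] xy
      by (simp add: N linear_IJ word_simps linear_rules[OF f])
  qed
qed

text \<open>After expansion, \<open>bracket_i_i_j\<close> handles two factors \<open>i\<close>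
  against one \<open>j\<close>, and vanishing torsion handles \<open>i\<close> against
  \<open>i\<close>. The only mixed brackets that survive appear as \<open>I\<close> times the left
  side of compatibility for \<open>b\<close>.\<close>

lemma compatible_deform:
  assumes b: "odd_bracket b" "compatible b" "torsionfree b"
  shows "compatible (deform_at i I b)"
  unfolding compatible_def
proof (intro ballI)
  fix x y assume xy: "x \<in> S" "y \<in> S"
  note odd = odd_bracketD[OF b(1)] and N = torsionfreeD[OF b(3)] and P = bracket_i_i_j[OF b]
  have C: "I (b (i x) (j y)) + I (b (j x) (i y)) =
     I (J (b (i x) y)) + I (J (b x (i y))) + I (I (b (j x) y)) + I (I (b x (j y)))"
    using arg_cong[OF compatibleD[OF b(2) xy], of I] by (simp add: linear_IJ)
  let ?b = "deform_at i I b"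
  show "?b (i x) (j y) + ?b (j x) (i y) =
      J (?b (i x) y) + J (?b x (i y)) + I (?b (j x) y) + I (?b x (j y))"
  proof (rule eq_if_functionals_eq)
    fix f :: "'v \<Rightarrow> real" assume f: "linear f"
    show "f (?b (i x) (j y) + ?b (j x) (i y)) =
        f (J (?b (i x) y) + J (?b x (i y)) + I (?b (j x) y) + I (?b x (j y)))"
      using arg_cong[OF C, of f] xy
      by (simp add: deform_at_def N P linear_IJ word_simps linear_rules[OF f])
  qed
qed

text \<open>Two signs cancel when \<open>i\<close> passes \<open>j\<close> twice, so
  \<open>i j j\<close> commutes with \<open>i\<close>, and deformations by commuting tensors
  commute. The relation for \<open>b\<close> is then used at \<open>(i x, y)\<close>, at
  \<open>(x, i y)\<close> and, under \<open>I\<close>, at \<open>(x, y)\<close>.\<close>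

lemma cubic_deform_deform:
  assumes b: "odd_bracket b" "cubic_deform b \<mu>"
  shows "cubic_deform (deform_at i I b) \<mu>"
  unfolding cubic_deform_def
proof (intro ballI)
  fix x y assume xy: "x \<in> S" "y \<in> S"
  note odd = odd_bracketD[OF b(1)]
  have R: "deform_at (\<lambda>x. i (j (j x))) (\<lambda>v. I (J (J v))) b x y = \<mu> *\<^sub>R deform_at i I b x y"
    if "x \<in> S" "y \<in> S" for x y using b(2) that by (simp add: cubic_deform_def)
  let ?b = "deform_at i I b" and ?d = "deform_at (\<lambda>x. i (j (j x))) (\<lambda>v. I (J (J v)))"
  have "?d ?b x y = ?d b (i x) y + ?d b x (i y) - I (?d b x y)"
    using xy by (simp add: deform_at_def word_simps linear_IJ algebra_simps)
  also have "\<dots> = \<mu> *\<^sub>R deform_at i I ?b x y"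
    using xy by (simp add: R linear_IJ deform_at_def[of i I ?b] algebra_simps)
  finally show "?d ?b x y = \<mu> *\<^sub>R deform_at i I ?b x y" .
qed

lemma square_deform_deform:
  assumes b: "odd_bracket b" "compatible b" "square_deform b \<eta>" "cubic_deform b \<mu>"
  shows "square_deform (deform_at i I b) ((4 * \<mu> - \<eta>) / 3)"
  unfolding square_deform_def
proof (intro ballI)
  fix x y assume xy: "x \<in> S" "y \<in> S"
  note odd = odd_bracketD[OF b(1)]
  let ?b = "deform_at i I b" and ?d = "deform_at j J"
  have E: "?d (?d b) x y = \<eta> *\<^sub>R b x y" if "x \<in> S" "y \<in> S" for x y
    using b(3) that by (simp add: square_deform_def)
  have E0: "I (?d (?d b) x y) = \<eta> *\<^sub>R I (b x y)" using E xy by (simp add: linear_IJ)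
  have C0: "J (b (i x) (j y)) + J (b (j x) (i y)) =
     J (J (b (i x) y)) + J (J (b x (i y))) + J (I (b (j x) y)) + J (I (b x (j y)))"
    using arg_cong[OF compatibleD[OF b(2) xy], of J] by (simp add: linear_IJ)
  have R: "deform_at (\<lambda>x. i (j (j x))) (\<lambda>v. I (J (J v))) b x y = \<mu> *\<^sub>R ?b x y"
    using b(4) xy by (simp add: cubic_deform_def)
  show "?d (?d ?b) x y = ((4 * \<mu> - \<eta>) / 3) *\<^sub>R ?b x y"
  proof (rule eq_if_functionals_eq)
    fix f :: "'v \<Rightarrow> real" assume f: "linear f"
    note fs = deform_at_def word_simps odd linear_IJ linear_rules[OF f]
    \<comment> \<open>\<open>E\<close> at \<open>(i x, y)\<close> and \<open>(x, i y)\<close>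
      together with \<open>E0\<close> makes up deformation by \<open>i\<close> of the square
      relation. Compatibility at \<open>(j x, y)\<close> and \<open>(x, j y)\<close> together with
      \<open>C0\<close> makes up deformation by \<open>j\<close> of the compatibility identity.
      \<open>R\<close> evaluates the deformation by \<open>i j j\<close>.\<close>
    have "3 * f (?d (?d ?b) x y) = (4 * \<mu> - \<eta>) * f (?b x y)"
      using arg_cong[OF E[OF closed(1)[OF xy(1)] xy(2)], of f]
        arg_cong[OF E[OF xy(1) closed(1)[OF xy(2)]], of f]
        arg_cong[OF E0, of f] arg_cong[OF C0, of f] arg_cong[OF R, of f]
        arg_cong[OF compatibleD[OF b(2) closed(2)[OF xy(1)] xy(2)], of f]
        arg_cong[OF compatibleD[OF b(2) xy(1) closed(2)[OF xy(2)]], of f]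
        xy
      by (simp add: fs) (simp add: algebra_simps)
    then show "f (?d (?d ?b) x y) = f (((4 * \<mu> - \<eta>) / 3) *\<^sub>R ?b x y)"
      by (simp add: linear_rules[OF f] field_simps)
  qed
qed

section \<open>Powers of \<open>i\<close>\<close>

lemma iter_closed [simp]: "x \<in> S \<Longrightarrow> (i ^^ m) x \<in> S"
  by (induction m) auto

lemma linear_iter: "linear (I ^^ m)"
proof (induction m)
  case (Suc m)
  then show ?case using linear_compose[of "I ^^ m" I] linear_I by (simp add: o_def)
qed (use linear_id in \<open>simp add: id_def\<close>)

text \<open>With L and R for \<open>i\<close> in the two arguments, the claim is (L^m - I^m)(R - I)
  = 0. It follows from (L - I)(R - I) = 0 because L - I divides L^m - I^m.\<close>

lemma torsionfree_iter_left:
  assumes b: "torsionfree b" and xy: "x \<in> S" "y \<in> S"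
  shows "b ((i ^^ m) x) (i y) = I (b ((i ^^ m) x) y) + (I ^^ m) (b x (i y)) - (I ^^ Suc m) (b x y)"
proof (induction m)
  case (Suc m)
  have "I (b ((i ^^ m) x) (i y)) =
      I (I (b ((i ^^ m) x) y)) + (I ^^ Suc m) (b x (i y)) - (I ^^ Suc (Suc m)) (b x y)"
    using arg_cong[OF Suc, of I] by (simp add: linear_IJ)
  with xy show ?case using torsionfreeD[OF b, of "(i ^^ m) x" y] by simp
qed (simp add: xy)

text \<open>Likewise R - I divides R^l - I^l, so (L^m - I^m)(R^l - I^l) = 0. Equal exponents give
  the torsion of a power; the exponents 2 and \<open>m\<close> serve for compatibility with odd
  powers.\<close>

lemma torsionfree_iter:
  assumes b: "torsionfree b" and xy: "x \<in> S" "y \<in> S"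
  shows "b ((i ^^ m) x) ((i ^^ l) y) =
     (I ^^ l) (b ((i ^^ m) x) y) + (I ^^ m) (b x ((i ^^ l) y)) - (I ^^ (m + l)) (b x y)"
proof (induction l)
  case (Suc l)
  have c: "(I ^^ Suc m) v = (I ^^ m) (I v)" "I ((I ^^ m) v) = (I ^^ m) (I v)" for m v
    by (simp_all add: funpow_swap1)
  have "I (b ((i ^^ m) x) ((i ^^ l) y)) =
     I ((I ^^ l) (b ((i ^^ m) x) y)) + I ((I ^^ m) (b x ((i ^^ l) y))) - I ((I ^^ (m + l)) (b x y))"
    using arg_cong[OF Suc, of I] by (simp add: linear_IJ)
  with xy show ?case using torsionfree_iter_left[OF b xy(1), of "(i ^^ l) y" m]
    by (simp add: c)
qed (simp add: xy)

lemma i_i_j: "x \<in> S \<Longrightarrow> j (i (i x)) = i (i (j x))"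
  by (simp add: word_simps)

lemma J_I_iter_odd: "J ((I ^^ (2 * n + 1)) v) = - (I ^^ (2 * n + 1)) (J v)"
  by (induction n) (simp_all add: J_I linear_IJ)

text \<open>The exponent grows by two, and oddness is what lets \<open>J\<close> anticommute with
  the power of \<open>I\<close>. The induction hypothesis at \<open>(i (i x), y)\<close> yields the
  first bracket; \<open>torsionfree_iter\<close> frees the brackets with \<open>i i\<close> in front
  of one argument and the power in front of the other, and \<open>bracket_i_i_j\<close> treats those
  with \<open>i i\<close> against \<open>j\<close>.\<close>

lemma compatible_iter_odd:
  assumes b: "odd_bracket b" "compatible b" "torsionfree b" and xy: "x \<in> S" "y \<in> S"
  shows "b ((i ^^ (2 * n + 1)) x) (j y) + b (j x) ((i ^^ (2 * n + 1)) y) =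
     J (b ((i ^^ (2 * n + 1)) x) y) + J (b x ((i ^^ (2 * n + 1)) y))
      + (I ^^ (2 * n + 1)) (b (j x) y) + (I ^^ (2 * n + 1)) (b x (j y))"
  using xy
proof (induction n arbitrary: x y)
  case 0 then show ?case using compatibleD[OF b(2)] by simp
next
  case (Suc n)
  note xy = Suc.prems
  define m where "m = 2 * n + 1"
  have m: "2 * Suc n + 1 = m + 2" by (simp add: m_def)
  note N = torsionfree_iter[OF b(3)] and P = bracket_i_i_j[OF b]
  have s: "i ((i ^^ m) z) = (i ^^ m) (i z)" "I ((I ^^ m) v) = (I ^^ m) (I v)" for z v
    by (simp_all add: funpow_swap1)
  have JI: "J ((I ^^ m) v) = - (I ^^ m) (J v)" for v using J_I_iter_odd[of n v] by (simp only: m_def)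
  note lin = linear_rules[OF linear_iter, of m]
  have 1: "b ((i ^^ m) (i (i x))) (j y) + b (i (i (j x))) ((i ^^ m) y) =
     J (b ((i ^^ m) (i (i x))) y) + J (b (i (i x)) ((i ^^ m) y))
      + (I ^^ m) (b (i (i (j x))) y) + (I ^^ m) (b (i (i x)) (j y))"
    using Suc.IH[of "i (i x)" y] xy by (simp add: m_def i_i_j del: funpow.simps)
  have 2: "b (i (i z)) ((i ^^ m) y) =
      (I ^^ m) (b (i (i z)) y) + I (I (b z ((i ^^ m) y))) - (I ^^ m) (I (I (b z y)))"
    if "z \<in> S" for z using N[OF that xy(2), of 2 m] by (simp add: numeral_2_eq_2 s)
  have 3: "b (j x) (i (i ((i ^^ m) y))) =
      I (I (b (j x) ((i ^^ m) y))) + J (b x (i (i ((i ^^ m) y)))) - I (I (J (b x ((i ^^ m) y))))"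
    using P(2)[of x "(i ^^ m) y"] xy by simp
  show ?case
    unfolding m
  proof (rule eq_if_functionals_eq)
    fix f :: "'v \<Rightarrow> real" assume f: "linear f"
    show "f (b ((i ^^ (m + 2)) x) (j y) + b (j x) ((i ^^ (m + 2)) y)) =
     f (J (b ((i ^^ (m + 2)) x) y) + J (b x ((i ^^ (m + 2)) y))
      + (I ^^ (m + 2)) (b (j x) y) + (I ^^ (m + 2)) (b x (j y)))"
      using arg_cong[OF 1, of f] arg_cong[OF 3, of f] xy
      by (simp add: 2 P(1) s lin J_I JI linear_IJ linear_rules[OF f])
  qed
qed

end

section \<open>Sections and tensors\<close>

lemma linear_on_add: "linear_on S f \<Longrightarrow> u \<in> S \<Longrightarrow> v \<in> S \<Longrightarrow> f (u + v) = f u + f v"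
  and linear_on_scale: "linear_on S f \<Longrightarrow> u \<in> S \<Longrightarrow> f (a *\<^sub>R u) = a *\<^sub>R f u"
  by (auto simp: linear_on_def)

lemma linear_on_neg: "linear_on S f \<Longrightarrow> u \<in> S \<Longrightarrow> f (- u) = - f u"
  using linear_on_scale[of S f u "-1"] by simp

lemma linear_on_sum:
  assumes "linear_on S f" "subspace S" "\<And>j. j \<in> K \<Longrightarrow> v j \<in> S"
  shows "f (\<Sum>j\<in>K. a j *\<^sub>R v j) = (\<Sum>j\<in>K. a j *\<^sub>R f (v j))"
  using assms(3)
proof (induction K rule: infinite_finite_induct)
  case (insert j K)
  then show ?case
    using assms(1,2)
    by (simp add: linear_on_add linear_on_scale subspace_sum subspace_scale)
next
  case empty
  show ?case using linear_on_scale[OF assms(1) subspace_0[OF assms(2)], of 0] by simp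
qed (use linear_on_scale[OF assms(1) subspace_0[OF assms(2)], of 0] in simp)

text \<open>Precomposition with a linear projection of the ambient space onto \<open>S\<close> makes
  \<open>f\<close> linear everywhere.\<close>

lemma linear_on_extension:
  assumes "subspace S" "linear_on S f"
  obtains g where "linear g" "\<And>v. v \<in> S \<Longrightarrow> g v = f v"
proof -
  obtain P where P: "range P \<subseteq> S" "linear P" "\<forall>v\<in>S. P v = v"
    using linear_exists_left_inverse_on[OF linear_id assms(1)] by (auto simp: id_def)
  have "linear (\<lambda>v. f (P v))"
    using P assms(2)
    by (intro linearI) (auto simp: linear_on_def linear_add linear_cmul image_subset_iff)
  with P show ?thesis by (intro that[of "\<lambda>v. f (P v)"]) auto
qed

locale smooth_metric_bundle =
  fixes B :: "('m::{t2_space,second_countable_topology}, 'v::real_vector) metric_bundle"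
  assumes B: "metric_vector_bundle B"
begin

lemma vector_bundle: "vector_bundle B"
  and atlas: "smooth_atlas (dim_base B) (atlas B)"
  and fibre_subspace: "subspace (fibre B p)"
  using B by (auto simp: metric_vector_bundle_def vector_bundle_def)

lemmas fibre_closed = subspace_add[OF fibre_subspace] subspace_diff[OF fibre_subspace]
  subspace_neg[OF fibre_subspace] subspace_scale[OF fibre_subspace] subspace_0[OF fibre_subspace]

lemma triv:
  assumes "(U, \<Phi>) \<in> trivs B"
  shows "open U"
    and "p \<in> U \<Longrightarrow> linear_on (fibre B p) (\<lambda>v. \<Phi> p v i)"
    and "p \<in> U \<Longrightarrow> bij_betw (\<Phi> p) (fibre B p) (topspace (Euclidean_space (rank B)))"
  using vector_bundle assms by (auto simp: vector_bundle_def)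

lemma metric_sym: "u \<in> fibre B p \<Longrightarrow> v \<in> fibre B p \<Longrightarrow> metric B p u v = metric B p v u"
  using B by (auto simp: metric_vector_bundle_def)

lemma metric_linear: "u \<in> fibre B p \<Longrightarrow> linear_on (fibre B p) (metric B p u)"
  using B by (auto simp: metric_vector_bundle_def)

lemma metric_add_right: "u \<in> fibre B p \<Longrightarrow> v \<in> fibre B p \<Longrightarrow> w \<in> fibre B p \<Longrightarrow>
    metric B p u (v + w) = metric B p u v + metric B p u w"
  and metric_neg_right: "u \<in> fibre B p \<Longrightarrow> v \<in> fibre B p \<Longrightarrow> metric B p u (- v) = - metric B p u v"
  by (rule linear_on_add[OF metric_linear] linear_on_neg[OF metric_linear]; assumption)+

lemma metric_add_left: "u \<in> fibre B p \<Longrightarrow> v \<in> fibre B p \<Longrightarrow> w \<in> fibre B p \<Longrightarrow>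
    metric B p (v + w) u = metric B p v u + metric B p w u"
  and metric_neg_left: "u \<in> fibre B p \<Longrightarrow> v \<in> fibre B p \<Longrightarrow> metric B p (- v) u = - metric B p v u"
  using metric_sym[of "v + w" p u] metric_sym[of v p u] metric_sym[of w p u] metric_sym[of "- v" p u]
  by (simp_all add: fibre_closed metric_add_right metric_neg_right)

lemma metric_diff_right: "u \<in> fibre B p \<Longrightarrow> v \<in> fibre B p \<Longrightarrow> w \<in> fibre B p \<Longrightarrow>
    metric B p u (v - w) = metric B p u v - metric B p u w"
  and metric_diff_left: "u \<in> fibre B p \<Longrightarrow> v \<in> fibre B p \<Longrightarrow> w \<in> fibre B p \<Longrightarrow>
    metric B p (v - w) u = metric B p v u - metric B p w u"
  using metric_add_right[of u p v "- w"] metric_add_left[of u p v "- w"]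
  by (simp_all add: fibre_closed metric_neg_right metric_neg_left)

lemmas metric_simps = metric_add_right metric_add_left metric_diff_right metric_diff_left
  metric_neg_right metric_neg_left

section \<open>Local frames and smoothness of fibrewise linear expressions\<close>

lemma local_frame:
  assumes "(U, \<Phi>) \<in> trivs B" "p \<in> U" "j < rank B"
  shows "local_frame B \<Phi> j p \<in> fibre B p"
    and "\<Phi> p (local_frame B \<Phi> j p) = (\<lambda>i. if i = j then 1 else 0)"
proof -
  have *: "(\<lambda>i. if i = j then 1 else 0) \<in> \<Phi> p ` fibre B p"
    using triv(3)[OF assms(1,2)] assms(3) by (auto simp: bij_betw_def topspace_Euclidean_space)
  show "local_frame B \<Phi> j p \<in> fibre B p"
    "\<Phi> p (local_frame B \<Phi> j p) = (\<lambda>i. if i = j then 1 else 0)"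
    unfolding local_frame_def using inv_into_into[OF *] f_inv_into_f[OF *] by auto
qed

lemma frame_expansion:
  assumes U: "(U, \<Phi>) \<in> trivs B" "p \<in> U" and v: "v \<in> fibre B p"
  shows "v = (\<Sum>j<rank B. \<Phi> p v j *\<^sub>R local_frame B \<Phi> j p)" (is "v = ?s")
proof -
  have s: "?s \<in> fibre B p"
    using local_frame[OF U] by (auto intro: subspace_sum fibre_subspace subspace_scale)
  have "\<Phi> p ?s i = \<Phi> p v i" for i
  proof -
    have "\<Phi> p ?s i = (\<Sum>j<rank B. \<Phi> p v j * (if i = j then 1 else 0))"
      using linear_on_sum[OF triv(2)[OF U, of i] fibre_subspace,
          of "{..<rank B}" "\<lambda>j. local_frame B \<Phi> j p"
          "\<Phi> p v"] local_frame[OF U] by simp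
    also have "\<dots> = (if i < rank B then \<Phi> p v i else 0)"
      by (simp add: if_distrib[of "\<lambda>x. _ * x"] cong: if_cong)
    \<comment> \<open>The values of \<open>\<Phi> p\<close> lie in
      \<open>Euclidean_space (rank B)\<close>, so their coordinates from \<open>rank B\<close> on
      are 0.\<close>
    also have "\<dots> = \<Phi> p v i"
      using bij_betw_apply[OF triv(3)[OF U] v] by (simp add: topspace_Euclidean_space)
    finally show ?thesis .
  qed
  then have "\<Phi> p ?s = \<Phi> p v" by auto
  with triv(3)[OF U] s v show ?thesis by (auto simp: bij_betw_def inj_on_def)
qed

text \<open>By the frame expansion, \<open>F p (X p)\<close> is a finite sum of products of
  coordinates of \<open>X\<close> with values of \<open>F\<close> on the frame. The set
  \<open>W\<close> may be smaller than \<open>U\<close> because anchors are smooth only over the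
  part of \<open>U\<close> inside a chart domain.\<close>

lemma smooth_linear_app:
  assumes U: "(U, \<Phi>) \<in> trivs B" and W: "open W" "W \<subseteq> U"
    and X: "\<And>p. p \<in> W \<Longrightarrow> X p \<in> fibre B p" "\<And>j. j < rank B \<Longrightarrow> smooth_base_fun B W (\<lambda>p. \<Phi> p (X p) j)"
    and F: "\<And>p. p \<in> W \<Longrightarrow> linear_on (fibre B p) (F p)"
      "\<And>j. j < rank B \<Longrightarrow> smooth_base_fun B W (\<lambda>p. F p (local_frame B \<Phi> j p))"
  shows "smooth_base_fun B W (\<lambda>p. F p (X p))"
proof (rule smooth_fun_on_cong_imp[OF atlas W(1)])
  show "smooth_base_fun B W (\<lambda>p. \<Sum>j<rank B. \<Phi> p (X p) j * F p (local_frame B \<Phi> j p))"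
    using X F by (intro smooth_fun_on_sum[OF atlas W(1)] smooth_fun_on_mult[OF atlas W(1)]) auto
  fix p assume p: "p \<in> W"
  then have "p \<in> U" using W by auto
  then show "(\<Sum>j<rank B. \<Phi> p (X p) j * F p (local_frame B \<Phi> j p)) = F p (X p)"
    using linear_on_sum[OF F(1)[OF p] fibre_subspace, of "{..<rank B}" "\<lambda>j. local_frame B \<Phi> j p"
        "\<Phi> p (X p)"] local_frame[OF U] frame_expansion[OF U _ X(1)[OF p]] by simp
qed

lemma section_in_fibre: "X \<in> sections B \<Longrightarrow> X p \<in> fibre B p"
  by (auto simp: sections_def)

lemma section_smooth:
  "X \<in> sections B \<Longrightarrow> (U, \<Phi>) \<in> trivs B \<Longrightarrow> i < rank B \<Longrightarrow> smooth_base_fun B U (\<lambda>p. \<Phi> p (X p) i)"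
  by (auto simp: sections_def)

lemma section_combination:
  assumes "X \<in> sections B" "Y \<in> sections B"
  shows "(\<lambda>p. a *\<^sub>R X p + b *\<^sub>R Y p) \<in> sections B"
proof -
  have "smooth_base_fun B U (\<lambda>p. \<Phi> p (a *\<^sub>R X p + b *\<^sub>R Y p) i)"
      if U: "(U, \<Phi>) \<in> trivs B" "i < rank B" for U \<Phi> i
  proof (rule smooth_fun_on_cong_imp[OF atlas triv(1)[OF U(1)]])
    show "smooth_base_fun B U (\<lambda>p. a * \<Phi> p (X p) i + b * \<Phi> p (Y p) i)"
      using section_smooth[OF assms(1) U] section_smooth[OF assms(2) U]
      by (intro smooth_fun_on_add[OF atlas triv(1)[OF U(1)]]
          smooth_fun_on_mult[OF atlas triv(1)[OF U(1)]]
          smooth_fun_on_const)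
    fix p assume "p \<in> U"
    from triv(2)[OF U(1) this, of i]
    show "a * \<Phi> p (X p) i + b * \<Phi> p (Y p) i = \<Phi> p (a *\<^sub>R X p + b *\<^sub>R Y p) i"
      using section_in_fibre[OF assms(1), of p] section_in_fibre[OF assms(2), of p]
      by (simp add: linear_on_def fibre_closed)
  qed
  then show ?thesis
    using assms by (auto simp: sections_def intro!: fibre_closed)
qed

lemma section_add: "X \<in> sections B \<Longrightarrow> Y \<in> sections B \<Longrightarrow> (\<lambda>p. X p + Y p) \<in> sections B"
  and section_diff: "X \<in> sections B \<Longrightarrow> Y \<in> sections B \<Longrightarrow> (\<lambda>p. X p - Y p) \<in> sections B"
  and section_scale: "X \<in> sections B \<Longrightarrow> (\<lambda>p. a *\<^sub>R X p) \<in> sections B"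
  and section_neg: "X \<in> sections B \<Longrightarrow> (\<lambda>p. - X p) \<in> sections B"
  using section_combination[of X Y 1 1] section_combination[of X Y 1 "-1"]
    section_combination[of X X a 0] section_combination[of X X "-1" 0] by simp_all

section \<open>Tensors, their compositions and powers\<close>

lemma tensor_linear: "tensor B I \<Longrightarrow> linear_on (fibre B p) (I p)"
  and tensor_in_fibre: "tensor B I \<Longrightarrow> v \<in> fibre B p \<Longrightarrow> I p v \<in> fibre B p"
  by (auto simp: tensor_def)

lemma triv_tensor_linear:
  "tensor B I \<Longrightarrow> (U, \<Phi>) \<in> trivs B \<Longrightarrow> p \<in> U \<Longrightarrow> linear_on (fibre B p) (\<lambda>v. \<Phi> p (I p v) i)"
  using triv(2)[of U \<Phi> p i] tensor_linear[of I p] tensor_in_fibre[of I _ p]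
  by (auto simp: linear_on_def)

lemma tensor_frame_smooth:
  "tensor B I \<Longrightarrow> (U, \<Phi>) \<in> trivs B \<Longrightarrow> i < rank B \<Longrightarrow> j < rank B \<Longrightarrow>
    smooth_base_fun B U (\<lambda>p. \<Phi> p (I p (local_frame B \<Phi> j p)) i)"
  by (auto simp: tensor_def)

lemma section_tensor_app:
  assumes I: "tensor B I" and X: "X \<in> sections B"
  shows "tensor_app I X \<in> sections B"
proof -
  have "smooth_base_fun B U (\<lambda>p. \<Phi> p (tensor_app I X p) i)"
      if U: "(U, \<Phi>) \<in> trivs B" "i < rank B" for U \<Phi> i
    unfolding tensor_app_def
    using smooth_linear_app[OF U(1) triv(1)[OF U(1)] order.refl, of X "\<lambda>p v. \<Phi> p (I p v) i"]
      section_in_fibre[OF X] section_smooth[OF X U(1)] triv_tensor_linear[OF I U(1)]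
      tensor_frame_smooth[OF I U] by auto
  then show ?thesis
    using tensor_in_fibre[OF I section_in_fibre[OF X]] by (auto simp: sections_def tensor_app_def)
qed

lemma tensor_comp:
  assumes I: "tensor B I" and J: "tensor B J"
  shows "tensor B (\<lambda>p v. I p (J p v))"
proof -
  have "smooth_base_fun B U (\<lambda>p. \<Phi> p (I p (J p (local_frame B \<Phi> j p))) i)"
    if U: "(U, \<Phi>) \<in> trivs B" "i < rank B" and j: "j < rank B" for U \<Phi> i j
    using smooth_linear_app[OF U(1) triv(1)[OF U(1)] order.refl,
        of "\<lambda>p. J p (local_frame B \<Phi> j p)" "\<lambda>p v. \<Phi> p (I p v) i"]
      tensor_in_fibre[OF J local_frame(1)[OF U(1) _ j]] tensor_frame_smooth[OF J U(1) _ j]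
          triv_tensor_linear[OF I U(1)]
      tensor_frame_smooth[OF I U] by auto
  moreover have "linear_on (fibre B p) (\<lambda>v. I p (J p v))" for p
    using tensor_linear[OF I, of p] tensor_linear[OF J, of p] tensor_in_fibre[OF J, of _ p]
    by (auto simp: linear_on_def)
  ultimately show ?thesis
    using tensor_in_fibre[OF I tensor_in_fibre[OF J]] by (auto simp: tensor_def)
qed

lemma skew_tensorD:
  assumes "skew_tensor B I"
  shows "tensor B I"
    and "u \<in> fibre B p \<Longrightarrow> v \<in> fibre B p \<Longrightarrow> metric B p (I p u) v = - metric B p u (I p v)"
  using assms by (auto simp: skew_tensor_def eq_neg_iff_add_eq_0)

lemma tensor_power_odd:
  assumes "tensor B I"
  shows "tensor B (tensor_power I (2 * n + 1))"
proof (induction n)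
  case (Suc n)
  have "tensor_power I (2 * Suc n + 1) = (\<lambda>p v. I p (I p (tensor_power I (2 * n + 1) p v)))"
    by (simp add: tensor_power_def fun_eq_iff)
  with tensor_comp[OF assms tensor_comp[OF assms Suc]] show ?case by simp
qed (simp add: assms tensor_power_def)

text \<open>Every factor moved across the metric costs a sign, and the number of factors is
  odd.\<close>

lemma skew_tensor_power_odd:
  assumes I: "skew_tensor B I"
  shows "skew_tensor B (tensor_power I (2 * n + 1))"
proof -
  note t = skew_tensorD(1)[OF I]
  have "metric B p (tensor_power I (2 * n + 1) p u) v =
      - metric B p u (tensor_power I (2 * n + 1) p v)"
    if "u \<in> fibre B p" "v \<in> fibre B p" for p u v
    using that
  proof (induction n arbitrary: u)
    case 0
    then show ?case using skew_tensorD(2)[OF I] by (simp add: tensor_power_def)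
  next
    case (Suc n)
    let ?T = "tensor_power I (2 * n + 1)"
    have "?T p v \<in> fibre B p" using tensor_in_fibre[OF tensor_power_odd[OF t]] Suc.prems by blast
    moreover have "tensor_power I (2 * Suc n + 1) p u = ?T p (I p (I p u))"
      "tensor_power I (2 * Suc n + 1) p v = I p (I p (?T p v))"
      by (simp_all add: tensor_power_def funpow_swap1)
    ultimately show ?case
      using Suc.IH[of "I p (I p u)"] Suc.prems tensor_in_fibre[OF t] skew_tensorD(2)[OF I] by simp
  qed
  then show ?thesis
    using tensor_power_odd[OF t] by (auto simp: skew_tensor_def)
qed

lemma bracket_section:
  "bilinear_bracket B br \<Longrightarrow> X \<in> sections B \<Longrightarrow> Y \<in> sections B \<Longrightarrow> br X Y \<in> sections B"
  by (simp add: bilinear_bracket_def)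

lemma bracket_combination:
  assumes "bilinear_bracket B br" "X \<in> sections B" "Y \<in> sections B" "Z \<in> sections B"
  shows "br (\<lambda>p. a *\<^sub>R X p + b *\<^sub>R Y p) Z = (\<lambda>p. a *\<^sub>R br X Z p + b *\<^sub>R br Y Z p)"
    and "br Z (\<lambda>p. a *\<^sub>R X p + b *\<^sub>R Y p) = (\<lambda>p. a *\<^sub>R br Z X p + b *\<^sub>R br Z Y p)"
  using assms by (simp_all add: bilinear_bracket_def)

lemma bracket_linear:
  assumes "bilinear_bracket B br" "X \<in> sections B" "Y \<in> sections B" "Z \<in> sections B"
  shows "br (\<lambda>p. X p + Y p) Z = (\<lambda>p. br X Z p + br Y Z p)"
    and "br (\<lambda>p. X p - Y p) Z = (\<lambda>p. br X Z p - br Y Z p)"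
    and "br (\<lambda>p. a *\<^sub>R X p) Z = (\<lambda>p. a *\<^sub>R br X Z p)"
    and "br (\<lambda>p. - X p) Z = (\<lambda>p. - br X Z p)"
    and "br Z (\<lambda>p. X p + Y p) = (\<lambda>p. br Z X p + br Z Y p)"
    and "br Z (\<lambda>p. X p - Y p) = (\<lambda>p. br Z X p - br Z Y p)"
    and "br Z (\<lambda>p. a *\<^sub>R X p) = (\<lambda>p. a *\<^sub>R br Z X p)"
    and "br Z (\<lambda>p. - X p) = (\<lambda>p. - br Z X p)"
  using bracket_combination[OF assms, of 1 1] bracket_combination[OF assms, of 1 "-1"]
    bracket_combination[OF assms, of a 0] bracket_combination[OF assms, of "-1" 0] by simp_all

section \<open>Deformations of pre-Courant and Courant structures\<close>

lemma pre_courantD: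
  assumes "pre_courant B \<Theta>"
  shows "anchor_map B (anchor \<Theta>)" "bilinear_bracket B (bracket \<Theta>)"
    and "X \<in> sections B \<Longrightarrow> Y \<in> sections B \<Longrightarrow> Z \<in> sections B \<Longrightarrow>
      anchor_act B \<Theta> X (\<lambda>q. metric B q (Y q) (Z q)) p =
        metric B p (bracket \<Theta> X Y p) (Z p) + metric B p (Y p) (bracket \<Theta> X Z p)"
    and "X \<in> sections B \<Longrightarrow> Y \<in> sections B \<Longrightarrow> Z \<in> sections B \<Longrightarrow>
      anchor_act B \<Theta> X (\<lambda>q. metric B q (Y q) (Z q)) p =
        metric B p (X p) (bracket \<Theta> Y Z p + bracket \<Theta> Z Y p)"
  using assms unfolding pre_courant_def by blast+

lemma anchor_linear: "anchor_map B \<rho> \<Longrightarrow> linear_on (fibre B p) (\<lambda>u. \<rho> p u c i)"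
  unfolding anchor_map_def by blast

lemma anchor_map_deform:
  assumes \<rho>: "anchor_map B \<rho>" and I: "tensor B I"
  shows "anchor_map B (\<lambda>p u. \<rho> p (I p u))"
proof -
  have "smooth_base_fun B (U \<inter> fst c) (\<lambda>p. \<rho> p (I p (local_frame B \<Phi> j p)) c i)"
    if U: "(U, \<Phi>) \<in> trivs B" and c: "c \<in> atlas B" "i < dim_base B" and j: "j < rank B" for U \<Phi> c i j
  proof (rule smooth_linear_app[OF U, where F = "\<lambda>p u. \<rho> p u c i"])
    show "open (U \<inter> fst c)"
      using triv(1)[OF U] atlas c by (cases c) (auto simp: smooth_atlas_def is_chart_def)
    show "smooth_base_fun B (U \<inter> fst c) (\<lambda>p. \<rho> p (local_frame B \<Phi> j p) c i)" if "j < rank B" for j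
      using \<rho> U c that by (auto simp: anchor_map_def)
    show "smooth_base_fun B (U \<inter> fst c) (\<lambda>p. \<Phi> p (I p (local_frame B \<Phi> j p)) l)" if "l < rank B" for l
      using smooth_fun_on_subset[OF tensor_frame_smooth[OF I U that j]] by auto
    show "I p (local_frame B \<Phi> j p) \<in> fibre B p" if "p \<in> U \<inter> fst c" for p
      using tensor_in_fibre[OF I local_frame(1)[OF U _ j]] that by auto
  qed (use anchor_linear[OF \<rho>] in auto)
  moreover have "linear_on (fibre B p) (\<lambda>u. \<rho> p (I p u) c i)" for p c i
    using anchor_linear[OF \<rho>, of p c i] tensor_linear[OF I, of p] tensor_in_fibre[OF I, of _ p]
    by (auto simp: linear_on_def)
  ultimately show ?thesis
    using \<rho> tensor_in_fibre[OF I] by (auto simp: anchor_map_def image_subset_iff)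
qed

lemma bracket_deform_eq:
  "bracket (deform I \<Theta>) X Y =
    (\<lambda>p. bracket \<Theta> (tensor_app I X) Y p + bracket \<Theta> X (tensor_app I Y) p
      - tensor_app I (bracket \<Theta> X Y) p)"
  by (simp add: deform_def tensor_app_def)

lemma tensor_app_combination:
  assumes "tensor B I" "X \<in> sections B" "Y \<in> sections B"
  shows "tensor_app I (\<lambda>p. a *\<^sub>R X p + b *\<^sub>R Y p) =
      (\<lambda>p. a *\<^sub>R tensor_app I X p + b *\<^sub>R tensor_app I Y p)"
proof
  fix p
  show "tensor_app I (\<lambda>p. a *\<^sub>R X p + b *\<^sub>R Y p) p = a *\<^sub>R tensor_app I X p + b *\<^sub>R tensor_app I Y p"
    using tensor_linear[OF assms(1), of p] section_in_fibre[OF assms(2), of p]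
        section_in_fibre[OF assms(3), of p]
    by (simp add: tensor_app_def linear_on_def fibre_closed)
qed

lemma bilinear_bracket_deform:
  assumes br: "bilinear_bracket B (bracket \<Theta>)" and I: "tensor B I"
  shows "bilinear_bracket B (bracket (deform I \<Theta>))"
proof -
  note t = section_tensor_app[OF I] and c = bracket_combination[OF br]
  have "bracket (deform I \<Theta>) X Y \<in> sections B" if "X \<in> sections B" "Y \<in> sections B" for X Y
    using that unfolding bracket_deform_eq
    by (intro section_add section_diff t bracket_section[OF br])
  then show ?thesis
    unfolding bilinear_bracket_def
    by (auto simp: bracket_deform_eq tensor_app_combination[OF I] c t bracket_section[OF br]
        fun_eq_iff algebra_simps)
qed

lemma anchor_act_deform: "anchor_act B (deform I \<Theta>) X f = anchor_act B \<Theta> (tensor_app I X) f"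
  by (simp add: anchor_act_def deform_def tensor_app_def)

text \<open>Linearity of the derivation in the function is obtained from bilinearity of the bracket,
  which avoids any appeal to differentiability of the metric coefficients.\<close>

lemma anchor_act_skew:
  assumes \<Theta>: "pre_courant B \<Theta>" and I: "skew_tensor B I"
    and s: "X \<in> sections B" "Y \<in> sections B" "Z \<in> sections B"
  shows "anchor_act B \<Theta> X (\<lambda>q. metric B q (tensor_app I Y q) (Z q)) p =
    - anchor_act B \<Theta> X (\<lambda>q. metric B q (Y q) (tensor_app I Z q)) p"
proof -
  note I' = skew_tensorD(1)[OF I] and br = pre_courantD(2)[OF \<Theta>]
  note t = section_tensor_app[OF I']
  have "(\<lambda>q. metric B q (tensor_app I Y q) (Z q)) = (\<lambda>q. metric B q (- Y q) (tensor_app I Z q))"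
    using skew_tensorD(2)[OF I] section_in_fibre s tensor_in_fibre[OF I']
    by (auto simp: tensor_app_def metric_neg_left fun_eq_iff)
  moreover have "anchor_act B \<Theta> X (\<lambda>q. metric B q (- Y q) (tensor_app I Z q)) p =
      - anchor_act B \<Theta> X (\<lambda>q. metric B q (Y q) (tensor_app I Z q)) p"
    using s pre_courantD(3)[OF \<Theta> s(1) section_neg[OF s(2)] t[OF s(3)], of p]
      pre_courantD(3)[OF \<Theta> s(1,2) t[OF s(3)], of p] section_in_fibre[OF bracket_section[OF br]]
      section_in_fibre
    by (simp add: bracket_linear[OF br _ _ s(1)] t metric_neg_left)
  ultimately show ?thesis by simp
qed

text \<open>The right sides of both axioms expand to the derivative of \<open><Y, Z>\<close> along
  \<open>I X\<close> plus the derivatives of \<open><I Y, Z>\<close> and \<open><Y, I Z>\<close>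
  along \<open>X\<close>. The last two cancel by \<open>anchor_act_skew\<close>, and the first is
  the deformed anchor acting.\<close>

lemma pre_courant_deform:
  assumes \<Theta>: "pre_courant B \<Theta>" and I: "skew_tensor B I"
  shows "pre_courant B (deform I \<Theta>)"
proof -
  note I' = skew_tensorD(1)[OF I] and br = pre_courantD(2)[OF \<Theta>]
  note t = section_tensor_app[OF I'] and f = section_in_fibre and b = bracket_section[OF br]
  have skew: "metric B p (I p u) v = - metric B p u (I p v)"
      if "u \<in> fibre B p" "v \<in> fibre B p" for p u v
    using skew_tensorD(2)[OF I] that .
  have "anchor_act B (deform I \<Theta>) X (\<lambda>q. metric B q (Y q) (Z q)) p =
      metric B p (bracket (deform I \<Theta>) X Y p) (Z p) + metric B p (Y p) (bracket (deform I \<Theta>) X Z p) \<and>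
    anchor_act B (deform I \<Theta>) X (\<lambda>q. metric B q (Y q) (Z q)) p =
      metric B p (X p) (bracket (deform I \<Theta>) Y Z p + bracket (deform I \<Theta>) Z Y p)"
    if s: "X \<in> sections B" "Y \<in> sections B" "Z \<in> sections B" for X Y Z p
  proof -
    note in_fibre = f[OF s(1), of p] f[OF s(2), of p] f[OF s(3), of p]
      f[OF t[OF s(1)], of p] f[OF t[OF s(2)], of p] f[OF t[OF s(3)], of p]
    have brf: "bracket \<Theta> U V p \<in> fibre B p" "tensor_app I (bracket \<Theta> U V) p \<in> fibre B p"
      if "U \<in> sections B" "V \<in> sections B" for U V
      using f[OF b[OF that]] f[OF t[OF b[OF that]]] by auto
    note e = in_fibre brf s t fibre_closed metric_simps
    have app: "I p (X p) = tensor_app I X p" for X by (simp add: tensor_app_def)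
    note sk = anchor_act_skew[OF \<Theta> I s, of p]
    have "metric B p (bracket (deform I \<Theta>) X Y p) (Z p)
        + metric B p (Y p) (bracket (deform I \<Theta>) X Z p) =
      anchor_act B \<Theta> (tensor_app I X) (\<lambda>q. metric B q (Y q) (Z q)) p
      + anchor_act B \<Theta> X (\<lambda>q. metric B q (tensor_app I Y q) (Z q)) p
      + anchor_act B \<Theta> X (\<lambda>q. metric B q (Y q) (tensor_app I Z q)) p"
      using skew[OF brf(1)[OF s(1,2)] in_fibre(3)] skew[OF in_fibre(2) brf(1)[OF s(1,3)]]
      by (simp add: deform_def e pre_courantD(3)[OF \<Theta>] app)
    moreover have "metric B p (X p) (bracket (deform I \<Theta>) Y Z p + bracket (deform I \<Theta>) Z Y p) =
      anchor_act B \<Theta> (tensor_app I X) (\<lambda>q. metric B q (Y q) (Z q)) p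
      + anchor_act B \<Theta> X (\<lambda>q. metric B q (tensor_app I Y q) (Z q)) p
      + anchor_act B \<Theta> X (\<lambda>q. metric B q (Y q) (tensor_app I Z q)) p"
      using skew[OF in_fibre(1) brf(1)[OF s(2,3)]] skew[OF in_fibre(1) brf(1)[OF s(3,2)]]
      by (simp add: deform_def e pre_courantD(4)[OF \<Theta>] app)
    ultimately show ?thesis using sk by (simp add: anchor_act_deform)
  qed
  moreover have "anchor_map B (anchor (deform I \<Theta>))"
    using anchor_map_deform[OF pre_courantD(1)[OF \<Theta>] I'] by (simp add: deform_def)
  ultimately show ?thesis
    using bilinear_bracket_deform[OF br I'] unfolding pre_courant_def by blast
qed

lemma nijenhuisD:
  assumes "nijenhuis B \<Theta> I" "X \<in> sections B" "Y \<in> sections B"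
  shows "bracket \<Theta> (tensor_app I X) (tensor_app I Y) = tensor_app I (bracket (deform I \<Theta>) X Y)"
  using assms by (auto simp: nijenhuis_def tensor_app_def fun_eq_iff)

lemma tensor_extension:
  assumes "tensor B I"
  obtains I' where "linear I'" "\<And>v. v \<in> fibre B p \<Longrightarrow> I p v = I' v"
  using linear_on_extension[OF fibre_subspace tensor_linear[OF assms]] by metis

lemma courant_deform:
  assumes \<Theta>: "courant B \<Theta>" and I: "skew_tensor B I" and N: "nijenhuis B \<Theta> I"
  shows "courant B (deform I \<Theta>)"
proof -
  have pre: "pre_courant B \<Theta>" using \<Theta> by (simp add: courant_def)
  note I' = skew_tensorD(1)[OF I] and br = pre_courantD(2)[OF pre]
  note t = section_tensor_app[OF I'] and f = section_in_fibre and b = bracket_section[OF br]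
  let ?b = "bracket \<Theta>" and ?d = "bracket (deform I \<Theta>)" and ?i = "tensor_app I"
  have d: "?d X Y \<in> sections B" if "X \<in> sections B" "Y \<in> sections B" for X Y
    using bracket_section[OF bilinear_bracket_deform[OF br I'] that] .
  have leibniz: "?b X (?b Y Z) p = ?b (?b X Y) Z p + ?b Y (?b X Z) p"
    if "X \<in> sections B" "Y \<in> sections B" "Z \<in> sections B" for X Y Z p
    using \<Theta> that unfolding courant_def by blast
  have "?d X (?d Y Z) p = ?d (?d X Y) Z p + ?d Y (?d X Z) p"
    if s: "X \<in> sections B" "Y \<in> sections B" "Z \<in> sections B" for X Y Z p
  proof -
    obtain I' where I': "linear I'" "\<And>v. v \<in> fibre B p \<Longrightarrow> I p v = I' v"
      using tensor_extension[OF skew_tensorD(1)[OF I]] by blast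
    have ip: "?i U p = I' (U p)" if "U \<in> sections B" for U
      using I'(2) f[OF that] by (simp add: tensor_app_def)
    have d_p: "?d U V p = ?b (?i U) V p + ?b U (?i V) p - I' (?b U V p)"
      if "U \<in> sections B" "V \<in> sections B" for U V
      using that by (simp add: bracket_deform_eq ip b)
    have NI: "?b (?i U) (?i V) p = I' (?b (?i U) V p) + I' (?b U (?i V) p) - I' (I' (?b U V p))"
      if "U \<in> sections B" "V \<in> sections B" for U V
      using that by (simp add: nijenhuisD[OF N] ip d d_p linear_rules[OF I'(1)])
    have right: "?b U (?d V W) p = ?b U (?b (?i V) W) p + ?b U (?b V (?i W)) p - ?b U (?i (?b V W)) p"
      and left: "?b (?d V W) U p = ?b (?b (?i V) W) U p + ?b (?b V (?i W)) U p - ?b (?i (?b V W)) U p"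
      if "U \<in> sections B" "V \<in> sections B" "W \<in> sections B" for U V W
      unfolding bracket_deform_eq using that
      by (simp_all add: bracket_linear[OF br] t b section_add)
    \<comment> \<open>Vanishing torsion puts the nested brackets into a form sorted by the number of
      factors \<open>I'\<close> outside: none with two \<open>?i\<close> inside, one with one, two
      with none. Each group then satisfies the Leibniz identity by itself, as an instance or a sum
      of instances of \<open>leibniz\<close>.\<close>
    have rightd: "?d U (?d V W) p =
       ?b (?i U) (?b (?i V) W) p + ?b (?i U) (?b V (?i W)) p + ?b U (?b (?i V) (?i W)) p
       - I' (?b (?i U) (?b V W) p) - I' (?b U (?b (?i V) W) p) - I' (?b U (?b V (?i W)) p)
       + I' (I' (?b U (?b V W) p))"
      if "U \<in> sections B" "V \<in> sections B" "W \<in> sections B" for U V W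
      using that
      by (simp add: d_p[of U] d t b right nijenhuisD[OF N, symmetric]
          NI[of U "?b V W"] linear_rules[OF I'(1)])
    have leftd: "?d (?d V W) U p =
       ?b (?b (?i V) W) (?i U) p + ?b (?b V (?i W)) (?i U) p + ?b (?b (?i V) (?i W)) U p
       - I' (?b (?b V W) (?i U) p) - I' (?b (?b (?i V) W) U p) - I' (?b (?b V (?i W)) U p)
       + I' (I' (?b (?b V W) U p))"
      if "U \<in> sections B" "V \<in> sections B" "W \<in> sections B" for U V W
      using that
      by (simp add: d_p[of _ U] d t b left nijenhuisD[OF N, symmetric]
          NI[of "?b V W" U] linear_rules[OF I'(1)])
    show ?thesis
      using s by (simp add: rightd leftd leibniz[of _ "?i Y" Z] leibniz[of _ Y "?i Z"]
          leibniz[of _ Y Z]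
          leibniz[of _ "?i Y" "?i Z"] t linear_rules[OF I'(1)])
  qed
  then show ?thesis using pre_courant_deform[OF pre I] unfolding courant_def by blast
qed

end

section \<open>The hierarchy\<close>

locale anticommuting_tensors = smooth_metric_bundle B
  for B :: "('m::{t2_space,second_countable_topology}, 'v::real_vector) metric_bundle" +
  fixes I J :: "('m, 'v) tensor"
  assumes skew_I: "skew_tensor B I" and skew_J: "skew_tensor B J"
    and anticommute: "u \<in> fibre B p \<Longrightarrow> J p (I p u) = - I p (J p u)"
begin

section \<open>Reduction to a single point\<close>

lemmas tensor_I = skew_tensorD(1)[OF skew_I] and tensor_J = skew_tensorD(1)[OF skew_J]
lemmas closed_I = section_tensor_app[OF tensor_I] tensor_in_fibre[OF tensor_I]
lemmas closed_J = section_tensor_app[OF tensor_J] tensor_in_fibre[OF tensor_J]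

text \<open>\<open>I p\<close> and \<open>J p\<close> are controlled on the fibre only, whereas the
  pointwise calculus wants linear maps that anticommute on the whole ambient space. Precomposing
  both with the same projection \<open>P\<close> works: the tensors preserve the fibre, so the inner
  \<open>P\<close> in a composition acts as the identity.\<close>

lemma pointwise_extension:
  obtains I' J' where
    "anticommuting_pair (sections B) (tensor_app I) (tensor_app J) (\<lambda>X p. - X p) I' J'"
    "\<And>v. v \<in> fibre B p \<Longrightarrow> I p v = I' v" "\<And>v. v \<in> fibre B p \<Longrightarrow> J p v = J' v"
proof -
  obtain P where P: "range P \<subseteq> fibre B p" "linear P" "\<forall>v\<in>fibre B p. P v = v"
    using linear_exists_left_inverse_on[OF linear_id fibre_subspace[of p]] by (auto simp: id_def)
  have l: "linear (\<lambda>v. K p (P v))" if "tensor B K" for K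
    using P tensor_linear[OF that, of p]
    by (intro linearI) (auto simp: linear_on_def linear_add linear_cmul image_subset_iff)
  have neg: "K p (- v) = - K p v" if "tensor B K" "v \<in> fibre B p" for K v p
    using linear_on_neg[OF tensor_linear[OF that(1)] that(2)] .
  have PJ: "P (K p (P v)) = K p (P v)" if "tensor B K" for K v
    using P tensor_in_fibre[OF that] by auto
  have "anticommuting_pair (sections B) (tensor_app I) (tensor_app J) (\<lambda>X p. - X p)
      (\<lambda>v. I p (P v)) (\<lambda>v. J p (P v))"
  proof (rule anticommuting_pair.intro)
    show "J p (P (I p (P v))) = - I p (P (J p (P v)))" for v
      using P anticommute by (auto simp: PJ tensor_I tensor_J image_subset_iff)
    show "tensor_app J (tensor_app I X) = (\<lambda>p. - tensor_app I (tensor_app J X) p)"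
      if "X \<in> sections B" for X
      using anticommute section_in_fibre[OF that] by (simp add: tensor_app_def)
    show "tensor_app I (\<lambda>p. - X p) = (\<lambda>p. - tensor_app I X p)"
      "tensor_app J (\<lambda>p. - X p) = (\<lambda>p. - tensor_app J X p)"
      if "X \<in> sections B" for X
      using neg[OF tensor_I] neg[OF tensor_J] section_in_fibre[OF that]
      by (simp_all add: tensor_app_def)
  qed (simp_all add: closed_I closed_J section_neg l tensor_I tensor_J)
  with P show ?thesis by (intro that[of "\<lambda>v. I p (P v)" "\<lambda>v. J p (P v)"]) auto
qed

definition cubic :: "('m, 'v) tensor" where "cubic = (\<lambda>p v. I p (J p (J p v)))"

lemma tensor_cubic: "tensor B cubic"
  unfolding cubic_def by (rule tensor_comp[OF tensor_I tensor_comp[OF tensor_J tensor_J]])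

lemma tensor_app_cubic: "tensor_app cubic = (\<lambda>X. tensor_app I (tensor_app J (tensor_app J X)))"
  by (simp add: cubic_def tensor_app_def fun_eq_iff)

lemma cubic_commute: "u \<in> fibre B p \<Longrightarrow> cubic p (I p u) = I p (cubic p u)"
  and J_J_I: "u \<in> fibre B p \<Longrightarrow> J p (J p (I p u)) = cubic p u"
proof -
  assume u: "u \<in> fibre B p"
  have "J p (- I p (J p u)) = - J p (I p (J p u))"
    using u by (intro linear_on_neg[OF tensor_linear[OF tensor_J]] closed_I closed_J)
  with u show J_J_I: "J p (J p (I p u)) = cubic p u"
    by (simp add: anticommute closed_I closed_J cubic_def)
  then show "cubic p (I p u) = I p (cubic p u)" by (simp add: cubic_def)
qed

lemma cubic_extension:
  assumes "v \<in> fibre B p"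
    and "\<And>v. v \<in> fibre B p \<Longrightarrow> I p v = I' v" and "\<And>v. v \<in> fibre B p \<Longrightarrow> J p v = J' v"
  shows "cubic p v = I' (J' (J' v))"
  using assms(2)[OF closed_J(2)[OF closed_J(2)[OF assms(1)]]] assms(1)
  by (simp add: cubic_def closed_J(2) flip: assms(3))

lemma bracket_in_fibre:
  "bilinear_bracket B br \<Longrightarrow> X \<in> sections B \<Longrightarrow> Y \<in> sections B \<Longrightarrow> br X Y p \<in> fibre B p"
  by (rule section_in_fibre[OF bracket_section])

text \<open>Entry into the pointwise calculus: bracket values lie in the fibre, where
  \<open>K'\<close> agrees with \<open>K p\<close>.\<close>

lemma bracket_deform_at:
  assumes "bilinear_bracket B (bracket \<Theta>)" "X \<in> sections B" "Y \<in> sections B"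
    and "\<And>v. v \<in> fibre B p \<Longrightarrow> K p v = K' v"
  shows "bracket (deform K \<Theta>) X Y p = deform_at (tensor_app K) K' (\<lambda>X Y. bracket \<Theta> X Y p) X Y"
  using assms by (simp add: deform_def deform_at_def bracket_in_fibre)

lemma bracket_deform_deform_at:
  assumes br: "bilinear_bracket B (bracket \<Theta>)" and XY: "X \<in> sections B" "Y \<in> sections B"
    and K: "tensor B K" and L: "tensor B L"
    and K': "\<And>v. v \<in> fibre B p \<Longrightarrow> K p v = K' v" and L': "\<And>v. v \<in> fibre B p \<Longrightarrow> L p v = L' v"
  shows "bracket (deform K (deform L \<Theta>)) X Y p =
    deform_at (tensor_app K) K' (deform_at (tensor_app L) L' (\<lambda>X Y. bracket \<Theta> X Y p)) X Y"
  using XY by (simp add: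
      bracket_deform_at[where p = p and K = K and K' = K', OF bilinear_bracket_deform[OF br L] XY K']
      deform_at_def[of "tensor_app K"] bracket_deform_at[where p = p and K = L and K' = L',
          OF br _ _ L'] section_tensor_app[OF K])

text \<open>The two anchors are those of \<open>I J\<close> and \<open>J I\<close>, which add up to
  0; compatibility is thus a condition on brackets only.\<close>

lemma concomitant_anchor:
  assumes "anchor_map B (anchor \<Theta>)" "u \<in> fibre B p"
  shows "anchor (concomitant \<Theta> J I) p u = (\<lambda>c i. 0)"
proof -
  have "anchor \<Theta> p (- I p (J p u)) c i = - anchor \<Theta> p (I p (J p u)) c i" for c i
    using linear_on_neg[OF anchor_linear[OF assms(1)]] assms(2) by (simp add: closed_I closed_J)
  with assms(2) show ?thesis
    by (simp add: concomitant_def struct_add_def deform_def anticommute fun_eq_iff)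
qed

lemma odd_bracketI:
  fixes I' J' :: "'v \<Rightarrow> 'v"
  assumes "anticommuting_pair (sections B) (tensor_app I) (tensor_app J) (\<lambda>X p. - X p) I' J'"
    and "bilinear_bracket B (bracket \<Theta>)"
  shows "anticommuting_pair.odd_bracket (sections B) (\<lambda>X p. - X p) (\<lambda>X Y. bracket \<Theta> X Y p)"
  using bracket_linear[OF assms(2)] by (simp add: anticommuting_pair.odd_bracket_def[OF assms(1)])

lemma compatible_pair_iff:
  assumes \<Theta>: "pre_courant B \<Theta>"
  shows "compatible_pair B \<Theta> J I \<longleftrightarrow> (\<forall>X\<in>sections B. \<forall>Y\<in>sections B. \<forall>p.
    bracket \<Theta> (tensor_app I X) (tensor_app J Y) p + bracket \<Theta> (tensor_app J X) (tensor_app I Y) p =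
    J p (bracket \<Theta> (tensor_app I X) Y p) + J p (bracket \<Theta> X (tensor_app I Y) p)
    + I p (bracket \<Theta> (tensor_app J X) Y p) + I p (bracket \<Theta> X (tensor_app J Y) p))"
proof -
  note br = pre_courantD(2)[OF \<Theta>]
  have "bracket (concomitant \<Theta> J I) X Y p = 0 \<longleftrightarrow>
      bracket \<Theta> (tensor_app I X) (tensor_app J Y) p + bracket \<Theta> (tensor_app J X) (tensor_app I Y) p =
      J p (bracket \<Theta> (tensor_app I X) Y p) + J p (bracket \<Theta> X (tensor_app I Y) p)
      + I p (bracket \<Theta> (tensor_app J X) Y p) + I p (bracket \<Theta> X (tensor_app J Y) p)"
    if XY: "X \<in> sections B" "Y \<in> sections B" for X Y p
  proof -
    obtain I' J' where pair: "anticommuting_pair (sections B) (tensor_app I) (tensor_app J) (\<lambda>X p. - X p)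
        I' J'"
      and I': "\<And>v. v \<in> fibre B p \<Longrightarrow> I p v = I' v" and J': "\<And>v. v \<in> fibre B p \<Longrightarrow> J p v = J' v"
      using pointwise_extension[where p = p] by blast
    show ?thesis
      using anticommuting_pair.concomitant_eq_0_iff[OF pair odd_bracketI[OF pair br, of p] XY] XY
        bracket_deform_deform_at[where p = p and K = I and L = J and K' = I' and L' = J',
            OF br XY tensor_I tensor_J I' J']
        bracket_deform_deform_at[where p = p and K = J and L = I and K' = J' and L' = I',
            OF br XY tensor_J tensor_I J' I']
      by (simp add: concomitant_def struct_add_def bracket_in_fibre[OF br] closed_I closed_J I' J')
  qed
  then show ?thesis
    using concomitant_anchor[OF pre_courantD(1)[OF \<Theta>]] skew_I skew_J
    by (auto simp: compatible_pair_def struct_eq_def struct_zero_def anticommute fun_eq_iff)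
qed

lemma nijenhuis_iff:
  "nijenhuis B \<Theta> I \<longleftrightarrow> (\<forall>X\<in>sections B. \<forall>Y\<in>sections B. \<forall>p.
     bracket \<Theta> (tensor_app I X) (tensor_app I Y) p = I p (bracket (deform I \<Theta>) X Y p))"
  by (simp add: nijenhuis_def tensor_I)

text \<open>The invariant carried along the hierarchy \<open>\<Theta>\<^sub>k\<close>: the constant \<open>\<eta>\<close> changes with k, \<open>\<mu>\<close> does not.\<close>

definition hierarchy_member :: "real \<Rightarrow> real \<Rightarrow> ('m, 'v) courant_data \<Rightarrow> bool" where
  "hierarchy_member \<mu> \<eta> \<Theta> \<longleftrightarrow> pre_courant B \<Theta> \<and> compatible_pair B \<Theta> J I \<and> nijenhuis B \<Theta> I \<and>
     struct_eq B (deform J (deform J \<Theta>)) (struct_scale \<eta> \<Theta>) \<and>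
     struct_eq B (deform cubic \<Theta>) (struct_scale \<mu> (deform I \<Theta>))"

lemma hierarchy_member_pointwise:
  assumes \<Theta>: "hierarchy_member \<mu> \<eta> \<Theta>"
    and pair: "anticommuting_pair (sections B) (tensor_app I) (tensor_app J) (\<lambda>X p. - X p) I' J'"
    and I': "\<And>v. v \<in> fibre B p \<Longrightarrow> I p v = I' v" and J': "\<And>v. v \<in> fibre B p \<Longrightarrow> J p v = J' v"
  defines "b \<equiv> \<lambda>X Y. bracket \<Theta> X Y p"
  shows "anticommuting_pair.odd_bracket (sections B) (\<lambda>X p. - X p) b"
    and "anticommuting_pair.compatible (sections B) (tensor_app I) (tensor_app J) I' J' b"
    and "anticommuting_pair.torsionfree (sections B) (tensor_app I) I' b"
    and "anticommuting_pair.square_deform (sections B) (tensor_app J) J' b \<eta>"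
    and "anticommuting_pair.cubic_deform (sections B) (tensor_app I) (tensor_app J) I' J' b \<mu>"
proof -
  interpret pair: anticommuting_pair "sections B" "tensor_app I" "tensor_app J" "\<lambda>X p. - X p" I' J'
    by (rule pair)
  have pre: "pre_courant B \<Theta>" using \<Theta> by (simp add: hierarchy_member_def)
  note br = pre_courantD(2)[OF pre]
  note closed = bracket_in_fibre[OF br] closed_I closed_J
  note cubic' = cubic_extension[OF _ I' J']
  show "pair.odd_bracket b" unfolding b_def by (rule odd_bracketI[OF pair br])
  show "pair.compatible b"
    using \<Theta> compatible_pair_iff[OF pre]
    by (simp add: hierarchy_member_def pair.compatible_def b_def closed flip: I' J')
  show "pair.torsionfree b"
    unfolding pair.torsionfree_def b_def
  proof (intro ballI)
    fix X Y assume XY: "X \<in> sections B" "Y \<in> sections B"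
    have "bracket \<Theta> (tensor_app I X) (tensor_app I Y) p = I p (bracket (deform I \<Theta>) X Y p)"
      using \<Theta> XY by (simp add: hierarchy_member_def nijenhuis_iff)
    also have "\<dots> = I' (bracket (deform I \<Theta>) X Y p)"
      using XY by (intro I' bracket_in_fibre bilinear_bracket_deform[OF br tensor_I])
    also have "bracket (deform I \<Theta>) X Y p = deform_at (tensor_app I) I' (\<lambda>X Y. bracket \<Theta> X Y p) X Y"
      by (rule bracket_deform_at[where p = p and K = I and K' = I', OF br XY I'])
    finally show "bracket \<Theta> (tensor_app I X) (tensor_app I Y) p =
        I' (bracket \<Theta> (tensor_app I X) Y p) + I' (bracket \<Theta> X (tensor_app I Y) p)
        - I' (I' (bracket \<Theta> X Y p))"
      by (simp add: deform_at_def pair.linear_IJ)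
  qed
  show "pair.square_deform b \<eta>"
    unfolding pair.square_deform_def b_def
    using \<Theta> bracket_deform_deform_at[where p = p and K = J and L = J and K' = J' and L' = J',
        OF br _ _ tensor_J tensor_J J' J']
    by (simp add: hierarchy_member_def struct_eq_def struct_scale_def)
  show "pair.cubic_deform b \<mu>"
    unfolding pair.cubic_deform_def b_def
  proof (intro ballI)
    fix X Y assume XY: "X \<in> sections B" "Y \<in> sections B"
    have "bracket (deform cubic \<Theta>) X Y p = \<mu> *\<^sub>R bracket (deform I \<Theta>) X Y p"
      using \<Theta> XY by (simp add: hierarchy_member_def struct_eq_def struct_scale_def)
    then show "deform_at (\<lambda>X. tensor_app I (tensor_app J (tensor_app J X))) (\<lambda>v. I' (J' (J' v)))
       (\<lambda>X Y. bracket \<Theta> X Y p) X Y = \<mu> *\<^sub>R deform_at (tensor_app I) I' (\<lambda>X Y. bracket \<Theta> X Y p) X Y"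
      using bracket_deform_at[where p = p and K = cubic and K' = "\<lambda>v. I' (J' (J' v))",
          OF br XY cubic']
        bracket_deform_at[where p = p and K = I and K' = I', OF br XY I']
      by (simp add: tensor_app_cubic)
  qed
qed

lemma hierarchy_member_deform:
  assumes \<Theta>: "hierarchy_member \<mu> \<eta> \<Theta>"
  shows "hierarchy_member \<mu> ((4 * \<mu> - \<eta>) / 3) (deform I \<Theta>)"
proof -
  let ?\<eta> = "(4 * \<mu> - \<eta>) / 3" and ?D = "deform I \<Theta>"
  have pre: "pre_courant B \<Theta>" using \<Theta> by (simp add: hierarchy_member_def)
  have pre1: "pre_courant B ?D" by (rule pre_courant_deform[OF pre skew_I])
  note br = pre_courantD(2)[OF pre] and br1 = pre_courantD(2)[OF pre1]
  have "(bracket ?D (tensor_app I X) (tensor_app J Y) p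
      + bracket ?D (tensor_app J X) (tensor_app I Y) p =
        J p (bracket ?D (tensor_app I X) Y p) + J p (bracket ?D X (tensor_app I Y) p)
        + I p (bracket ?D (tensor_app J X) Y p) + I p (bracket ?D X (tensor_app J Y) p)) \<and>
      bracket ?D (tensor_app I X) (tensor_app I Y) p = I p (bracket (deform I ?D) X Y p) \<and>
      bracket (deform J (deform J ?D)) X Y p = ?\<eta> *\<^sub>R bracket ?D X Y p \<and>
      bracket (deform cubic ?D) X Y p = \<mu> *\<^sub>R bracket (deform I ?D) X Y p"
    if XY: "X \<in> sections B" "Y \<in> sections B" for X Y p
  proof -
    obtain I' J' where pair: "anticommuting_pair (sections B) (tensor_app I) (tensor_app J) (\<lambda>X p. - X p)
        I' J'"
      and I': "\<And>v. v \<in> fibre B p \<Longrightarrow> I p v = I' v" and J': "\<And>v. v \<in> fibre B p \<Longrightarrow> J p v = J' v"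
      using pointwise_extension[where p = p] by blast
    interpret pair: anticommuting_pair "sections B" "tensor_app I" "tensor_app J" "\<lambda>X p. - X p" I' J'
      by (rule pair)
    let ?b = "\<lambda>X Y. bracket \<Theta> X Y p"
    let ?d = "deform_at (tensor_app I) I' ?b"
    have *: "pair.odd_bracket ?b" "pair.compatible ?b" "pair.torsionfree ?b"
      "pair.square_deform ?b \<eta>" "pair.cubic_deform ?b \<mu>"
      using hierarchy_member_pointwise[OF \<Theta> pair I' J'] by blast+
    have d: "bracket ?D U V p = ?d U V" if "U \<in> sections B" "V \<in> sections B" for U V
      by (rule bracket_deform_at[where p = p and K = I and K' = I', OF br that I'])
    have d_in_fibre: "?d U V \<in> fibre B p" if "U \<in> sections B" "V \<in> sections B" for U V
      using bracket_in_fibre[OF br1 that, of p] d[OF that] by simp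
    have dd: "bracket (deform K ?D) X Y p = deform_at (tensor_app K) K' ?d X Y"
      if "tensor B K" "\<And>v. v \<in> fibre B p \<Longrightarrow> K p v = K' v" for K K'
      by (rule bracket_deform_deform_at[where p = p and K = K and L = I and K' = K' and L' = I',
          OF br XY that(1) tensor_I that(2) I'])
    have JJ: "bracket (deform J (deform J ?D)) X Y p =
        deform_at (tensor_app J) J' (deform_at (tensor_app J) J' ?d) X Y"
      using bracket_deform_deform_at[where p = p and K = J and L = J and K' = J' and L' = J',
          OF br1 XY tensor_J tensor_J J' J'] XY
      by (simp add: deform_at_def[of "tensor_app J"] d closed_J(1))
    have "bracket ?D (tensor_app I X) (tensor_app J Y) p
        + bracket ?D (tensor_app J X) (tensor_app I Y) p =
        J p (bracket ?D (tensor_app I X) Y p) + J p (bracket ?D X (tensor_app I Y) p)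
        + I p (bracket ?D (tensor_app J X) Y p) + I p (bracket ?D X (tensor_app J Y) p)"
      using pair.compatibleD[OF pair.compatible_deform[OF *(1-3)] XY] XY
      by (simp add: I' J' d_in_fibre closed_I(1) closed_J(1) d)
    moreover have "bracket ?D (tensor_app I X) (tensor_app I Y) p = I p (bracket (deform I ?D) X Y p)"
      using pair.torsionfreeD[OF pair.torsionfree_deform[OF *(3)] XY] XY
        I'[OF bracket_in_fibre[OF bilinear_bracket_deform[OF br1 tensor_I] XY]]
      by (simp add: dd[OF tensor_I I'] d closed_I(1) deform_at_def[of _ _ ?d] pair.linear_IJ)
    moreover have "bracket (deform J (deform J ?D)) X Y p = ?\<eta> *\<^sub>R bracket ?D X Y p"
      using pair.square_deform_deform[OF *(1,2,4,5)] XY by (simp add: JJ d pair.square_deform_def)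
    moreover have "bracket (deform cubic ?D) X Y p = \<mu> *\<^sub>R bracket (deform I ?D) X Y p"
      using pair.cubic_deform_deform[OF *(1,5)] XY
      by (simp add: dd[OF tensor_cubic cubic_extension[OF _ I' J']] dd[OF tensor_I I']
          pair.cubic_deform_def tensor_app_cubic)
    ultimately show ?thesis by blast
  qed
  note brackets = this
  \<comment> \<open>The anchor is composed with the tensors on the inside, so the deformation
    performed first gives the outermost tensor.\<close>
  have "anchor \<Theta> p (I p (J p (J p u))) = (\<lambda>c i. ?\<eta> * anchor \<Theta> p (I p u) c i)"
    "anchor \<Theta> p (I p (cubic p u)) = (\<lambda>c i. \<mu> * anchor \<Theta> p (I p (I p u)) c i)"
    if u: "u \<in> fibre B p" for p u
  proof -
    have 1: "anchor \<Theta> p (J p (J p u)) = (\<lambda>c i. \<eta> * anchor \<Theta> p u c i)"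
      "anchor \<Theta> p (cubic p u) = (\<lambda>c i. \<mu> * anchor \<Theta> p (I p u) c i)" if "u \<in> fibre B p" for u
      using \<Theta> that by (simp_all add: hierarchy_member_def struct_eq_def deform_def struct_scale_def)
    \<comment> \<open>Since \<open>I J J = J J I\<close>, the anchor at \<open>cubic p u\<close> is
      evaluated by either relation. So a component of the anchor at \<open>I p u\<close> is 0, or
      \<open>\<mu> = \<eta>\<close> and then \<open>?\<eta>\<close> is the same number; the anchor
      part holds in both cases.\<close>
    have \<mu>\<eta>: "\<mu> * anchor \<Theta> p (I p u) c i = \<eta> * anchor \<Theta> p (I p u) c i" for c i
      using fun_cong[OF fun_cong[OF 1(1)[OF closed_I(2)[OF u]]], of c i]
        fun_cong[OF fun_cong[OF 1(2)[OF u]], of c i] by (simp only: J_J_I[OF u])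
    have "\<mu> * anchor \<Theta> p (I p u) c i = ?\<eta> * anchor \<Theta> p (I p u) c i" for c i
      using \<mu>\<eta>[of c i] by (auto simp: field_simps)
    then show "anchor \<Theta> p (I p (J p (J p u))) = (\<lambda>c i. ?\<eta> * anchor \<Theta> p (I p u) c i)"
      using 1(2)[OF u] by (simp only: cubic_def)
    show "anchor \<Theta> p (I p (cubic p u)) = (\<lambda>c i. \<mu> * anchor \<Theta> p (I p (I p u)) c i)"
      using 1(2)[OF closed_I(2)[OF u]] by (simp add: cubic_commute[OF u])
  qed
  note anchors = this
  have "anchor (deform J (deform J ?D)) p u = anchor (struct_scale ?\<eta> ?D) p u"
    "anchor (deform cubic ?D) p u = anchor (struct_scale \<mu> (deform I ?D)) p u"
    if "u \<in> fibre B p" for p u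
    using anchors[OF that] by (simp_all add: deform_def struct_scale_def)
  moreover have "bracket (deform J (deform J ?D)) X Y = bracket (struct_scale ?\<eta> ?D) X Y"
    "bracket (deform cubic ?D) X Y = bracket (struct_scale \<mu> (deform I ?D)) X Y"
    if "X \<in> sections B" "Y \<in> sections B" for X Y
    using brackets[OF that] by (simp_all add: struct_scale_def fun_eq_iff)
  ultimately have "struct_eq B (deform J (deform J ?D)) (struct_scale ?\<eta> ?D)"
    "struct_eq B (deform cubic ?D) (struct_scale \<mu> (deform I ?D))"
    by (simp_all add: struct_eq_def)
  with pre1 brackets show ?thesis
    by (simp add: hierarchy_member_def compatible_pair_iff[OF pre1] nijenhuis_iff)
qed

lemma hierarchy_member_iter:
  "hierarchy_member \<mu> \<eta> \<Theta> \<Longrightarrow> \<exists>\<eta>'. hierarchy_member \<mu> \<eta>' (deform_iter I k \<Theta>)"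
  unfolding deform_iter_def by (induction k) (auto dest: hierarchy_member_deform)

lemma anticommuting_power: "anticommuting_tensors B (tensor_power I (2 * n + 1)) J"
proof
  show "J p (tensor_power I (2 * n + 1) p u) = - tensor_power I (2 * n + 1) p (J p u)"
    if u: "u \<in> fibre B p" for u p
  proof -
    obtain I' J' where pair: "anticommuting_pair (sections B) (tensor_app I) (tensor_app J) (\<lambda>X p. - X p)
        I' J'"
      and I': "\<And>v. v \<in> fibre B p \<Longrightarrow> I p v = I' v" and J': "\<And>v. v \<in> fibre B p \<Longrightarrow> J p v = J' v"
      using pointwise_extension[where p = p] by blast
    have pow: "(I p ^^ m) v = (I' ^^ m) v \<and> (I p ^^ m) v \<in> fibre B p" if "v \<in> fibre B p" for m v
      using that by (induction m) (auto simp: I'[symmetric] closed_I)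
    from pow[OF u, of "2 * n + 1"] pow[OF closed_J(2)[OF u], of "2 * n + 1"]
      anticommuting_pair.J_I_iter_odd[OF pair, of n u]
    show ?thesis unfolding tensor_power_def using u J' by metis
  qed
qed (rule skew_tensor_power_odd skew_I skew_J B)+

text \<open>The deforming condition concerns \<open>J\<close> alone and is part of the invariant.
  The other two conditions are \<open>compatible_iter_odd\<close> and
  \<open>torsionfree_iter\<close> with equal exponents, read back from the pointwise
  calculus.\<close>

lemma deforming_nijenhuis_pair_power:
  assumes \<Theta>: "hierarchy_member \<mu> \<eta> \<Theta>"
  shows "deforming_nijenhuis_pair B \<Theta> J (tensor_power I (2 * n + 1))"
proof -
  let ?m = "2 * n + 1"
  let ?K = "tensor_power I ?m"
  \<comment> \<open>The power forms an anticommuting pair with \<open>J\<close>, so its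
    compatibility and Nijenhuis conditions also reduce to bracket identities at points.\<close>
  interpret power: anticommuting_tensors B ?K J by (rule anticommuting_power)
  have pre: "pre_courant B \<Theta>" using \<Theta> by (simp add: hierarchy_member_def)
  note br = pre_courantD(2)[OF pre]
  have app: "tensor_app ?K X = (tensor_app I ^^ ?m) X" for X
  proof -
    have "(tensor_app I ^^ m) X = (\<lambda>p. (I p ^^ m) (X p))" for m
      by (induction m) (simp_all add: tensor_app_def)
    then show ?thesis by (simp only: tensor_power_def tensor_app_def)
  qed
  have "bracket \<Theta> (tensor_app ?K X) (tensor_app J Y) p
      + bracket \<Theta> (tensor_app J X) (tensor_app ?K Y) p =
        J p (bracket \<Theta> (tensor_app ?K X) Y p) + J p (bracket \<Theta> X (tensor_app ?K Y) p)
        + ?K p (bracket \<Theta> (tensor_app J X) Y p) + ?K p (bracket \<Theta> X (tensor_app J Y) p) \<and>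
      bracket \<Theta> (tensor_app ?K X) (tensor_app ?K Y) p = ?K p (bracket (deform ?K \<Theta>) X Y p)"
    if XY: "X \<in> sections B" "Y \<in> sections B" for X Y p
  proof -
    obtain I' J' where pair: "anticommuting_pair (sections B) (tensor_app I) (tensor_app J) (\<lambda>X p. - X p)
        I' J'"
      and I': "\<And>v. v \<in> fibre B p \<Longrightarrow> I p v = I' v" and J': "\<And>v. v \<in> fibre B p \<Longrightarrow> J p v = J' v"
      using pointwise_extension[where p = p] by blast
    interpret pair: anticommuting_pair "sections B" "tensor_app I" "tensor_app J" "\<lambda>X p. - X p" I' J'
      by (rule pair)
    let ?b = "\<lambda>X Y. bracket \<Theta> X Y p"
    have *: "pair.odd_bracket ?b" "pair.compatible ?b" "pair.torsionfree ?b"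
      "pair.square_deform ?b \<eta>" "pair.cubic_deform ?b \<mu>"
      using hierarchy_member_pointwise[OF \<Theta> pair I' J'] by blast+
    have "(I p ^^ m) v = (I' ^^ m) v \<and> (I p ^^ m) v \<in> fibre B p" if "v \<in> fibre B p" for m v
      using that by (induction m) (auto simp: I'[symmetric] closed_I)
    then have K': "?K p v = (I' ^^ ?m) v" if "v \<in> fibre B p" for v
      using that unfolding tensor_power_def by blast
    have mm: "(I' ^^ (?m + ?m)) v = (I' ^^ ?m) ((I' ^^ ?m) v)" for v
      by (simp only: funpow_add o_apply)
    note closed = bracket_in_fibre[OF br] power.closed_I(1) closed_J(1)
    have K_d: "?K p (bracket (deform ?K \<Theta>) X Y p) =
        (I' ^^ ?m) (deform_at (tensor_app ?K) (I' ^^ ?m) (\<lambda>X Y. bracket \<Theta> X Y p) X Y)"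
      using K'[OF bracket_in_fibre[OF bilinear_bracket_deform[OF br power.tensor_I] XY]]
      by (simp only: bracket_deform_at[where p = p and K = ?K and K' = "I' ^^ ?m", OF br XY K'])
    have "bracket \<Theta> (tensor_app ?K X) (tensor_app ?K Y) p = ?K p (bracket (deform ?K \<Theta>) X Y p)"
      unfolding K_d deform_at_def linear_rules[OF pair.linear_iter]
      using pair.torsionfree_iter[OF *(3) XY, of ?m ?m] by (simp only: app mm)
    moreover have "bracket \<Theta> (tensor_app ?K X) (tensor_app J Y) p
        + bracket \<Theta> (tensor_app J X) (tensor_app ?K Y) p =
        J p (bracket \<Theta> (tensor_app ?K X) Y p) + J p (bracket \<Theta> X (tensor_app ?K Y) p)
        + ?K p (bracket \<Theta> (tensor_app J X) Y p) + ?K p (bracket \<Theta> X (tensor_app J Y) p)"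
      using pair.compatible_iter_odd[OF *(1-3) XY, of n] XY
        K'[OF closed(1)[OF closed(3)[OF XY(1)] XY(2)]] K'[OF closed(1)[OF XY(1) closed(3)[OF XY(2)]]]
        J'[OF closed(1)[OF closed(2)[OF XY(1)] XY(2)]] J'[OF closed(1)[OF XY(1) closed(2)[OF XY(2)]]]
      by (simp only: app)
    ultimately show ?thesis by blast
  qed
  then show ?thesis
    using \<Theta> skew_J
    by (auto simp: deforming_nijenhuis_pair_def deforming_def hierarchy_member_def
        power.compatible_pair_iff[OF pre] power.nijenhuis_iff simp del: One_nat_def)
qed

text \<open>The double bracket has four words in one \<open>I\<close> and two \<open>J\<close>;
  moving \<open>I\<close> to the front turns each of them into minus \<open>cubic\<close>.\<close>

lemma tensor_bracket_cubic:
  "u \<in> fibre B p \<Longrightarrow> tensor_bracket J (tensor_bracket I J) p u = - 4 *\<^sub>R cubic p u"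
proof -
  assume u: "u \<in> fibre B p"
  note neg = linear_on_neg[OF tensor_linear[OF tensor_J]] linear_on_neg[OF tensor_linear[OF tensor_I]]
  have diff: "J p (v - w) = J p v - J p w" if "v \<in> fibre B p" "w \<in> fibre B p" for v w
    using linear_on_add[OF tensor_linear[OF tensor_J] that(1), of "- w"] that
    by (simp add: neg fibre_closed)
  have "tensor_bracket J (tensor_bracket I J) p u = - cubic p u - cubic p u - cubic p u - cubic p u"
    using u by (simp add: tensor_bracket_def diff closed_I closed_J J_J_I anticommute neg
        fibre_closed cubic_def)
  also have "\<dots> = - 4 *\<^sub>R cubic p u"
    using scaleR_left_distrib[of "-2" "-2" "cubic p u"] by (simp add: scaleR_2)
  finally show ?thesis .
qed

text \<open>By \<open>sq\<close>, deforming twice by \<open>J\<close> and then by \<open>I\<close>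
  is \<open>\<eta>\<close> times deforming by \<open>I\<close>. As the double bracket is -4 times
  \<open>cubic\<close>, the assumption \<open>l\<close> becomes the stated relation after division
  by -4.\<close>

lemma deform_cubicI:
  assumes \<Theta>: "pre_courant B \<Theta>"
    and sq: "struct_eq B (deform J (deform J \<Theta>)) (struct_scale \<eta> \<Theta>)"
    and l: "struct_eq B (deform (tensor_bracket J (tensor_bracket I J)) \<Theta>)
           (struct_scale l (deform I (deform J (deform J \<Theta>))))"
  shows "struct_eq B (deform cubic \<Theta>) (struct_scale (- l * \<eta> / 4) (deform I \<Theta>))"
proof -
  note br = pre_courantD(2)[OF \<Theta>]
  let ?T = "tensor_bracket J (tensor_bracket I J)"
  have app: "tensor_app ?T X = (\<lambda>p. - (4 *\<^sub>R tensor_app cubic X p))" if "X \<in> sections B" for X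
    using tensor_bracket_cubic[OF section_in_fibre[OF that]] by (simp add: tensor_app_def)
  have sqb: "bracket (deform J (deform J \<Theta>)) X Y p = \<eta> *\<^sub>R bracket \<Theta> X Y p"
    if "X \<in> sections B" "Y \<in> sections B" for X Y p
    using sq that by (simp add: struct_eq_def struct_scale_def)
  have "bracket (deform cubic \<Theta>) X Y p = (- l * \<eta> / 4) *\<^sub>R bracket (deform I \<Theta>) X Y p"
    if XY: "X \<in> sections B" "Y \<in> sections B" for X Y p
  proof -
    have 1: "bracket (deform ?T \<Theta>) X Y p = l *\<^sub>R bracket (deform I (deform J (deform J \<Theta>))) X Y p"
      using l XY by (simp add: struct_eq_def struct_scale_def)
    have 2: "bracket (deform ?T \<Theta>) X Y p = - 4 *\<^sub>R bracket (deform cubic \<Theta>) X Y p"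
      using XY bracket_in_fibre[OF br XY, of p]
      by (simp add: deform_def app bracket_linear[OF br] section_tensor_app[OF tensor_cubic]
          section_scale
          tensor_bracket_cubic algebra_simps)
    have 3: "bracket (deform I (deform J (deform J \<Theta>))) X Y p = \<eta> *\<^sub>R bracket (deform I \<Theta>) X Y p"
      using XY linear_on_scale[OF tensor_linear[OF tensor_I] bracket_in_fibre[OF br XY, of p]]
      by (simp add: deform_def[of I] sqb closed_I(1) algebra_simps)
    have "bracket (deform cubic \<Theta>) X Y p = (- 1 / 4) *\<^sub>R (- 4 *\<^sub>R bracket (deform cubic \<Theta>) X Y p)"
      by simp
    also have "\<dots> = (- 1 / 4) *\<^sub>R l *\<^sub>R \<eta> *\<^sub>R bracket (deform I \<Theta>) X Y p"
      unfolding 2[symmetric] 1 3 ..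
    finally show ?thesis by simp
  qed
  moreover have "anchor \<Theta> p (cubic p u) c i = (- l * \<eta> / 4) * anchor \<Theta> p (I p u) c i"
    if u: "u \<in> fibre B p" for p u c i
  proof -
    have "anchor \<Theta> p (- 4 *\<^sub>R cubic p u) c i = - 4 * anchor \<Theta> p (cubic p u) c i"
      using linear_on_scale[OF anchor_linear[OF pre_courantD(1)[OF \<Theta>]], of "cubic p u" p "-4"]
        tensor_in_fibre[OF tensor_cubic u] by simp
    moreover have "anchor \<Theta> p (- 4 *\<^sub>R cubic p u) c i = l * anchor \<Theta> p (J p (J p (I p u))) c i"
      using l u by (simp add: struct_eq_def deform_def struct_scale_def tensor_bracket_cubic)
    moreover have "anchor \<Theta> p (J p (J p (I p u))) c i = \<eta> * anchor \<Theta> p (I p u) c i"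
      using sq closed_I(2)[OF u] by (simp add: struct_eq_def deform_def struct_scale_def)
    ultimately show ?thesis by simp
  qed
  then have "anchor (deform cubic \<Theta>) p u = anchor (struct_scale (- l * \<eta> / 4) (deform I \<Theta>)) p u"
    if "u \<in> fibre B p" for p u
    using that by (simp add: deform_def struct_scale_def fun_eq_iff)
  ultimately show ?thesis
    unfolding struct_eq_def by (simp add: struct_scale_def fun_eq_iff)
qed

end

theorem theorem3p7:
  fixes B :: "('m::{t2_space,second_countable_topology}, 'v::real_vector) metric_bundle"
    and \<Theta> :: "('m, 'v) courant_data"
    and I J :: "('m, 'v) tensor"
    and l\<^sub>0 :: real
  assumes "metric_vector_bundle B"
    and "pre_courant B \<Theta>"
    and "skew_tensor B I" and "skew_tensor B J"
    and "struct_eq B (deform (tensor_bracket J (tensor_bracket I J)) \<Theta>)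
           (struct_scale l\<^sub>0 (deform I (deform J (deform J \<Theta>))))"
    and "l\<^sub>0 \<notin> {4 / ((-3) ^ m - 1) | m :: nat. m \<ge> 1}"
    and "deforming_nijenhuis_pair B \<Theta> J I"
  shows "\<forall>k n :: nat.
           pre_courant B (deform_iter I k \<Theta>) \<and>
           (courant B \<Theta> \<longrightarrow> courant B (deform_iter I k \<Theta>)) \<and>
           deforming_nijenhuis_pair B (deform_iter I k \<Theta>) J (tensor_power I (2 * n + 1))"
proof -
  have comp: "compatible_pair B \<Theta> J I" and nij: "nijenhuis B \<Theta> I" and def: "deforming B \<Theta> J"
    using assms(7) by (auto simp: deforming_nijenhuis_pair_def)
  interpret anticommuting_tensors B I J
    using assms comp by unfold_locales (auto simp: compatible_pair_def)
  obtain \<eta> where sq: "struct_eq B (deform J (deform J \<Theta>)) (struct_scale \<eta> \<Theta>)"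
    using def by (auto simp: deforming_def)
  \<comment> \<open>The first parameter is fixed here by \<open>\<Theta>\<close> and stays the same
    along the whole hierarchy.\<close>
  have "hierarchy_member (- l\<^sub>0 * \<eta> / 4) \<eta> \<Theta>"
    using assms(2) comp nij sq deform_cubicI[OF assms(2) sq assms(5)]
    by (simp add: hierarchy_member_def)
  then have member: "\<exists>\<eta>'. hierarchy_member (- l\<^sub>0 * \<eta> / 4) \<eta>' (deform_iter I k \<Theta>)" for k
    by (rule hierarchy_member_iter)
  \<comment> \<open>Each deformation needs the Nijenhuis property for the structure already reached,
    which the invariant supplies for every \<open>k\<close>.\<close>
  have "courant B (deform_iter I k \<Theta>)" if "courant B \<Theta>" for k
  proof (induction k)
    case (Suc k)
    moreover have "nijenhuis B (deform_iter I k \<Theta>) I"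
      using member[of k] by (auto simp: hierarchy_member_def)
    ultimately show ?case
      using courant_deform[OF _ skew_I] by (simp add: deform_iter_def)
  qed (simp add: deform_iter_def that)
  moreover have "pre_courant B (deform_iter I k \<Theta>)" for k
    using member[of k] by (auto simp: hierarchy_member_def)
  moreover have "deforming_nijenhuis_pair B (deform_iter I k \<Theta>) J (tensor_power I (2 * n + 1))"
      for k n
    using member[of k] deforming_nijenhuis_pair_power by blast
  ultimately show ?thesis by blast
qed

end
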